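(* Let $(X,\|\cdot\|)$ be a finite-dimensional (non-Archimedean) normed space over a complete non-Archimedean nontrivially valued field $(K,|\cdot|)$, and let $G$ be the group of all affine isometries of $(X,\|\cdot\|)$. If $\dim X\ge 2$, then $X$, every ball (closed or open) in $X$, and every nonempty sphere in $X$ is $G$-paradoxical using four pieces.
   Context: A non-Archimedean valuation on a field $K$ is a function $|\cdot|\colon K\to[0,\infty)$ with $|x|=0\Leftrightarrow x=0$, $|xy|=|x||y|$, $|x+y|\le\max\{|x|,|y|\}$; it is trivial if $|x|=1$ for all $x\ne0$, and nontrivial otherwise. The pair $(K,|\cdot|)$ is then called a non-Archimedean valued field. It is complete if $K$ is a complete metric space under $d(x,y)=|x-y|$. A non-Archimedean norm on a $K$-linear space $X$ is a function $\|\cdot\|\colon X\to[0,\infty)$ with $\|x\|=0\Leftrightarrow x=0$, $\|\alpha x\|=|\alpha|\|x\|$, $\|x+y\|\le\max\{\|x\|,\|y\|\}$. All normed spaces over $K$ are understood to be non-Archimedean in this sense. For $x_0\in X$ and $r>0$: closed ball $B[x_0,r]=\{x:\|x-x_0\|\le r\}$, open ball $B(x_0,r)=\{x:\|x-x_0\|<r\}$, sphere $S[x_0,r]=\{x:\|x-x_0\|=r\}$. An affine isometry of $(X,\|\cdot\|)$ is a map $x\mapsto Lx+\tau$ with $L\colon X\to X$ an invertible linear map satisfying $\|Lx\|=\|x\|$ for all $x\in X$, and $\tau\in X$. Let $G$ be a group acting on a set $X$. A nonempty subset $E\subseteq X$ (not necessarily $G$-invariant) is $G$-paradoxical using $r$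 pieces if for some positive integers $m,l$ with $m+l=r$ there exist pairwise disjoint subsets $A_1,\dots,A_m,B_1,\dots,B_l$ of $E$ and elements $g_1,\dots,g_m,h_1,\dots,h_l\in G$ such that $E=A_1\sqcup\dots\sqcup A_m\sqcup B_1\sqcup\dots\sqcup B_l=\bigsqcup_{i=1}^m g_i(A_i)=\bigsqcup_{j=1}^l h_j(B_j)$, where $\sqcup$ and $\bigsqcup$ denote unions of pairwise disjoint sets. *)

theory Defs
  imports "HOL-Analysis.Analysis" "HOL-Algebra.Group_Action"
begin

section \<open>Non-Archimedean valued fields\<close>

locale nonarch_valued_field =
  fixes val :: "'k::field \<Rightarrow> real"
  assumes val_nonneg: "0 \<le> val a"
    and val_eq_0_iff: "val a = 0 \<longleftrightarrow> a = 0"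
    and val_mult: "val (a * b) = val a * val b"
    and val_ultrametric: "val (a + b) \<le> max (val a) (val b)"
begin

definition nontrivial :: bool
  where "nontrivial \<longleftrightarrow> \<not> (\<forall>a. a \<noteq> 0 \<longrightarrow> val a = 1)"

definition complete_field :: bool
  where "complete_field \<longleftrightarrow> Metric_space.mcomplete UNIV (\<lambda>a b. val (a - b))"

lemma val_one: "val 1 = 1"
  using val_mult[of 1 1] val_eq_0_iff[of 1] by simp

lemma val_minus: "val (- a) = val a"
proof -
  have "val (- 1) * val (- 1) = 1"
    using val_mult[of "- 1" "- 1"] val_one by simp
  then have "val (- 1) = 1"
    using val_nonneg[of "- 1"] by (simp add: square_eq_1_iff)
  then show ?thesis
    using val_mult[of "- 1" a] by simp
qed

lemma Metric_space_val: "Metric_space UNIV (\<lambda>a b. val (a - b))"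
proof
  show "0 \<le> val (a - b)" for a b
    by (rule val_nonneg)
  show "val (a - b) = val (b - a)" for a b
    using val_minus[of "a - b"] by simp
  show "val (a - b) = 0 \<longleftrightarrow> a = b" for a b
    by (simp add: val_eq_0_iff)
  show "val (a - c) \<le> val (a - b) + val (b - c)" for a b c
    using val_ultrametric[of "a - b" "b - c"] val_nonneg[of "a - b"] val_nonneg[of "b - c"] by simp
qed

end


section \<open>Non-Archimedean normed spaces\<close>

locale nonarch_normed_space =
  nonarch_valued_field val + vector_space smul
  for val :: "'k::field \<Rightarrow> real"
    and smul :: "'k \<Rightarrow> 'x::ab_group_add \<Rightarrow> 'x" +
  fixes nrm :: "'x \<Rightarrow> real"
  assumes nrm_nonneg: "0 \<le> nrm x"
    and nrm_eq_0_iff: "nrm x = 0 \<longleftrightarrow> x = 0"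
    and nrm_scale: "nrm (smul a x) = val a * nrm x"
    and nrm_ultrametric: "nrm (x + y) \<le> max (nrm x) (nrm y)"

definition closed_ball :: "('x::ab_group_add \<Rightarrow> real) \<Rightarrow> 'x \<Rightarrow> real \<Rightarrow> 'x set"
  where "closed_ball nrm x\<^sub>0 r = {x. nrm (x - x\<^sub>0) \<le> r}"

definition open_ball :: "('x::ab_group_add \<Rightarrow> real) \<Rightarrow> 'x \<Rightarrow> real \<Rightarrow> 'x set"
  where "open_ball nrm x\<^sub>0 r = {x. nrm (x - x\<^sub>0) < r}"

definition nrm_sphere :: "('x::ab_group_add \<Rightarrow> real) \<Rightarrow> 'x \<Rightarrow> real \<Rightarrow> 'x set"
  where "nrm_sphere nrm x\<^sub>0 r = {x. nrm (x - x\<^sub>0) = r}"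


section \<open>The group of affine isometries and its action\<close>

definition linear_isometry ::
    "('k::field \<Rightarrow> 'x::ab_group_add \<Rightarrow> 'x) \<Rightarrow> ('x \<Rightarrow> real) \<Rightarrow> ('x \<Rightarrow> 'x) \<Rightarrow> bool"
  where "linear_isometry smul nrm L \<longleftrightarrow>
    Vector_Spaces.linear smul smul L \<and> bij L \<and> (\<forall>x. nrm (L x) = nrm x)"

definition affine_isometries ::
    "('k::field \<Rightarrow> 'x::ab_group_add \<Rightarrow> 'x) \<Rightarrow> ('x \<Rightarrow> real) \<Rightarrow> ('x \<Rightarrow> 'x) set"
  where "affine_isometries smul nrm = {\<lambda>x. L x + \<tau> | L \<tau>. linear_isometry smul nrm L}"

definition affine_isometry_group ::
    "('k::field \<Rightarrow> 'x::ab_group_add \<Rightarrow> 'x) \<Rightarrow> ('x \<Rightarrow> real) \<Rightarrow> ('x \<Rightarrow> 'x) monoid"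
  where "affine_isometry_group smul nrm = (BijGroup UNIV)\<lparr>carrier := affine_isometries smul nrm\<rparr>"

lemma (in vector_space) linear_isometry_comp:
  assumes "linear_isometry scale nrm L" "linear_isometry scale nrm M"
  shows "linear_isometry scale nrm (L \<circ> M)"
  using assms unfolding linear_isometry_def
  by (auto intro: bij_comp Vector_Spaces.linear_compose)

lemma (in vector_space) linear_isometry_inv:
  assumes "linear_isometry scale nrm L"
  shows "linear_isometry scale nrm (inv_into UNIV L)"
proof -
  from assms interpret L: Vector_Spaces.linear scale scale L
    by (simp add: linear_isometry_def)
  from assms have bij: "bij L" and nrm: "\<And>x. nrm (L x) = nrm x"
    by (auto simp: linear_isometry_def)
  have L_inv: "L (inv_into UNIV L x) = x" for x
    using bij by (simp add: bij_is_surj surj_f_inv_f)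
  have inv_L: "inv_into UNIV L (L x) = x" for x
    using bij by (simp add: bij_is_inj)
  have "Vector_Spaces.linear scale scale (inv_into UNIV L)"
  proof
    show "inv_into UNIV L (x + y) = inv_into UNIV L x + inv_into UNIV L y" for x y
      by (metis L.add L_inv inv_L)
    show "inv_into UNIV L (scale c x) = scale c (inv_into UNIV L x)" for c x
      by (metis L.scale L_inv inv_L)
  qed
  moreover have "nrm (inv_into UNIV L x) = nrm x" for x
    by (metis nrm L_inv)
  ultimately show ?thesis
    using bij by (simp add: linear_isometry_def bij_imp_bij_inv)
qed

lemma (in vector_space) subgroup_affine_isometries:
  "subgroup (affine_isometries scale nrm) (BijGroup UNIV)"
proof -
  interpret B: group "BijGroup (UNIV :: 'b set)"
    by (rule group_BijGroup)
  have Bij_UNIV: "Bij (UNIV :: 'b set) = {f. bij f}"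
    by (auto simp: Bij_def)
  have carrier_B: "carrier (BijGroup (UNIV :: 'b set)) = {f. bij f}"
    by (simp add: BijGroup_def Bij_UNIV)
  have mult_B: "f \<otimes>\<^bsub>BijGroup UNIV\<^esub> g = f \<circ> g" if "bij f" "bij g" for f g :: "'b \<Rightarrow> 'b"
    using that by (simp add: BijGroup_def Bij_UNIV compose_def comp_def restrict_def)
  have one_B: "\<one>\<^bsub>BijGroup (UNIV :: 'b set)\<^esub> = (\<lambda>x. x)"
    by (simp add: BijGroup_def restrict_def)
  have bij: "bij f" if f: "f \<in> affine_isometries scale nrm" for f
  proof -
    obtain L \<tau> where L: "linear_isometry scale nrm L" and f: "f = (\<lambda>x. L x + \<tau>)"
      using f by (auto simp: affine_isometries_def)
    have "f = (\<lambda>x. x + \<tau>) \<circ> L"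
      using f by auto
    moreover have "bij (\<lambda>x. x + \<tau>)"
      by (rule bij_betw_byWitness[where f' = "\<lambda>x. x - \<tau>"]) auto
    ultimately show ?thesis
      using L by (auto simp: linear_isometry_def intro: bij_comp)
  qed
  have id: "linear_isometry scale nrm (\<lambda>x. x)"
    by (auto simp: linear_isometry_def linear_id[unfolded id_def] bij_id[unfolded id_def])
  show ?thesis
  proof (rule B.subgroupI)
    show "affine_isometries scale nrm \<subseteq> carrier (BijGroup UNIV)"
      using bij by (auto simp: carrier_B)
    show "affine_isometries scale nrm \<noteq> {}"
      using id by (auto simp: affine_isometries_def)
  next
    fix f g
    assume fg: "f \<in> affine_isometries scale nrm" "g \<in> affine_isometries scale nrm"
    then obtain L \<tau> M \<sigma> where L: "linear_isometry scale nrm L" "f = (\<lambda>x. L x + \<tau>)"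
      and M: "linear_isometry scale nrm M" "g = (\<lambda>x. M x + \<sigma>)"
      by (auto simp: affine_isometries_def)
    interpret L: Vector_Spaces.linear scale scale L
      using L by (simp add: linear_isometry_def)
    have "f \<circ> g = (\<lambda>x. (L \<circ> M) x + (L \<sigma> + \<tau>))"
      using L M by (auto simp: L.add add.assoc)
    then have "f \<circ> g \<in> affine_isometries scale nrm"
      using linear_isometry_comp[OF L(1) M(1)] unfolding affine_isometries_def by blast
    then show "f \<otimes>\<^bsub>BijGroup UNIV\<^esub> g \<in> affine_isometries scale nrm"
      using fg by (simp add: mult_B bij)
  next
    fix f
    assume f: "f \<in> affine_isometries scale nrm"
    then obtain L \<tau> where L: "linear_isometry scale nrm L" and f_eq: "f = (\<lambda>x. L x + \<tau>)"
      by (auto simp: affine_isometries_def)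
    define g where "g = (\<lambda>x. inv_into UNIV L x + - inv_into UNIV L \<tau>)"
    have g: "g \<in> affine_isometries scale nrm"
      using linear_isometry_inv[OF L] unfolding affine_isometries_def g_def by blast
    interpret I: Vector_Spaces.linear scale scale "inv_into UNIV L"
      using linear_isometry_inv[OF L] by (simp add: linear_isometry_def)
    have "g \<circ> f = (\<lambda>x. x)"
      using L by (auto simp: g_def f_eq I.add linear_isometry_def bij_is_inj)
    then have "g \<otimes>\<^bsub>BijGroup UNIV\<^esub> f = \<one>\<^bsub>BijGroup UNIV\<^esub>"
      using f g by (simp add: mult_B one_B bij)
    then have "inv\<^bsub>BijGroup UNIV\<^esub> f = g"
      using f g by (intro B.inv_equality) (auto simp: carrier_B bij)
    then show "inv\<^bsub>BijGroup UNIV\<^esub> f \<in> affine_isometries scale nrm"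
      using g by simp
  qed
qed

lemma (in vector_space) group_action_affine_isometries:
  "group_action (affine_isometry_group scale nrm) UNIV (\<lambda>g. g)"
proof -
  interpret B: group "BijGroup (UNIV :: 'b set)"
    by (rule group_BijGroup)
  have "group (affine_isometry_group scale nrm)"
    unfolding affine_isometry_group_def
    by (rule B.subgroup_imp_group[OF subgroup_affine_isometries])
  moreover have "(\<lambda>g. g) \<in> hom (affine_isometry_group scale nrm) (BijGroup UNIV)"
    using subgroup.subset[OF subgroup_affine_isometries[of nrm]]
    by (auto simp: hom_def affine_isometry_group_def)
  ultimately show ?thesis
    by (simp add: group_action_def group_hom_def group_hom_axioms_def B.group_axioms)
qed


section \<open>Paradoxical sets\<close>

text \<open>The space acted on is \<open>E\<close>, following \<^locale>\<open>group_action\<close>; the paradoxical set is \<open>S\<close>.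
  The pieces are indexed by \<open>0, \<dots>, m - 1\<close> and \<open>0, \<dots>, l - 1\<close>, and may be empty.\<close>

definition (in group_action) paradoxical_using :: "'c set \<Rightarrow> nat \<Rightarrow> bool"
  where "paradoxical_using S r \<longleftrightarrow> S \<noteq> {} \<and> S \<subseteq> E \<and>
    (\<exists>m l A B g h. 0 < m \<and> 0 < l \<and> m + l = r \<and>
      g \<in> {..<m} \<rightarrow> carrier G \<and> h \<in> {..<l} \<rightarrow> carrier G \<and>
      disjoint_family_on A {..<m} \<and> disjoint_family_on B {..<l} \<and>
      (\<Union>i<m. A i) \<inter> (\<Union>j<l. B j) = {} \<and>
      S = (\<Union>i<m. A i) \<union> (\<Union>j<l. B j) \<and>
      disjoint_family_on (\<lambda>i. \<phi> (g i) ` A i) {..<m} \<and> S = (\<Union>i<m. \<phi> (g i) ` A i) \<and>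
      disjoint_family_on (\<lambda>j. \<phi> (h j) ` B j) {..<l} \<and> S = (\<Union>j<l. \<phi> (h j) ` B j))"

abbreviation isometry_paradoxical ::
    "('k::field \<Rightarrow> 'x::ab_group_add \<Rightarrow> 'x) \<Rightarrow> ('x \<Rightarrow> real) \<Rightarrow> 'x set \<Rightarrow> nat \<Rightarrow> bool"
  where "isometry_paradoxical smul nrm \<equiv>
    group_action.paradoxical_using (affine_isometry_group smul nrm) UNIV (\<lambda>g. g)"

end

theory Submission
  imports Defs "HOL-Library.Function_Algebras"
begin

text \<open>Two isometries \<open>T False\<close> and \<open>T True\<close> are applied over and over to the points of a set; draw an edge
from each point to each of its two images. If every finite part of this graph has at most as many
edges as vertices, then the set is paradoxical with four pieces
(\<open>paradoxical_using_4_of_pseudoforest\<close>): Hall's theorem and the Banach mapping theorem give a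
bijection from edges to vertices that assigns to every edge one of its endpoints, and the four
pieces record the label of the edge assigned to a point and the end at which the point lies. This is
the graph-theoretic counterpart of the theorem that an action of a free group of rank two with cyclic point
stabilizers has a four-piece paradox, and it spares any discussion of words and stabilizers.

It remains to find such isometries close to the identity, since isometries that move the center by
less than \<open>r\<close> preserve spheres and balls of radius \<open>r\<close> about it. Choose two independent
coordinate functionals; they are bounded because the field is complete (\<open>coordinates_bounded\<close>). In
the plane of these coordinates take four lines in general position, two for each label \<open>l\<close>. Let
\<open>T l\<close> be the product of the two shears by a small scalar \<open>s\<close> that fix the lines with label \<open>l\<close>. If
\<open>y = T l x\<close>, then the displacement of \<open>y\<close> from \<open>x\<close> is \<open>s\<close> times the deviation of \<open>x\<close> from the first
line and of \<open>y\<close> from the second, in suitable coordinates.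

Suppose that a finite subgraph has more edges than vertices. After pruning, each vertex has at
least two half-edges and some vertex has three (\<open>core_exists\<close>). Its points solve a system of linear
equations that is a pencil in \<open>s\<close>; in the formal limit of infinite \<open>s\<close> the system says that every
point lies on the lines of all its half-edges, which is impossible at a vertex on three lines. The
limit only serves to show that the pencil is nondegenerate, whatever the valuation of \<open>s\<close>.
Hence for a given graph only finitely many \<open>s\<close> allow a solution
(\<open>finite_exceptional_parameters\<close>). There are countably many finite graphs, so by Baire's theorem
some arbitrarily small \<open>s\<close> allows none of them (\<open>small_scalar_avoiding_countable\<close>).\<close>

section \<open>Choosing endpoints: Hall's theorem and the Banach mapping theorem\<close>

text \<open>Rado's argument. Among all ways of deleting elements from the sets \<open>A i\<close> that keep Hall's
condition, take a maximal one; it exists by Zorn's lemma, because Hall's condition speaks about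
finitely many finite sets at a time. If two different elements \<open>x\<close> and \<open>y\<close> were left in one set,
deleting either of them would violate the condition on some finite families \<open>J\<close> and \<open>K\<close>, and
submodularity of the cardinality, applied to the corresponding unions, would contradict the
condition for \<open>J \<union> K\<close> together with \<open>i\<close> and for \<open>J \<inter> K\<close>. So every set has shrunk to a singleton,
and the singletons are distinct.\<close>

theorem infinite_hall:
  fixes A :: "'i \<Rightarrow> 'v set"
  assumes fin: "\<And>i. i \<in> I \<Longrightarrow> finite (A i)"
    and hall: "\<And>J. finite J \<Longrightarrow> J \<subseteq> I \<Longrightarrow> card J \<le> card (\<Union>(A ` J))"
  obtains \<sigma> where "inj_on \<sigma> I" and "\<And>i. i \<in> I \<Longrightarrow> \<sigma> i \<in> A i"
proof -
  \<comment> \<open>\<open>N R i\<close> is what is left of \<open>A i\<close> once the pairs in \<open>R\<close> are deleted.\<close>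
  define N where "N R i = A i - R `` {i}" for R i
  define \<P> where "\<P> = {R. \<forall>J. finite J \<longrightarrow> J \<subseteq> I \<longrightarrow> card J \<le> card (\<Union>(N R ` J))}"
  have finN: "finite (\<Union>(N R ` J))" if "finite J" "J \<subseteq> I" for R J
    using that fin by (auto simp: N_def)
  have "\<exists>M\<in>\<P>. \<forall>X\<in>\<P>. M \<subseteq> X \<longrightarrow> X = M"
  proof (rule subset_Zorn')
    fix C assume C: "subset.chain \<P> C"
    show "\<Union>C \<in> \<P>"
    proof (cases "C = {}")
      case True
      then show ?thesis using hall by (simp add: \<P>_def N_def)
    next
      case False
      have "card J \<le> card (\<Union>(N (\<Union>C) ` J))" if J: "finite J" "J \<subseteq> I" for J
      proof -
        have "finite (\<Union>C \<inter> (SIGMA i:J. A i))"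
          using J fin by (auto intro!: finite_SigmaI)
        then obtain R where R: "R \<in> C" "\<Union>C \<inter> (SIGMA i:J. A i) \<subseteq> R"
          using finite_subset_Union_chain[OF _ _ False C] by (metis inf_le1)
        have "N (\<Union>C) i = N R i" if "i \<in> J" for i
          using R that by (auto simp: N_def)
        then have "\<Union>(N (\<Union>C) ` J) = \<Union>(N R ` J)" by simp
        moreover have "R \<in> \<P>" using C R by (auto simp: subset.chain_def)
        ultimately show ?thesis using J by (auto simp: \<P>_def)
      qed
      then show ?thesis by (simp add: \<P>_def)
    qed
  qed
  then obtain R where R: "R \<in> \<P>" and max: "\<And>X. X \<in> \<P> \<Longrightarrow> R \<subseteq> X \<Longrightarrow> X = R" by blast
  have hallR: "card J \<le> card (\<Union>(N R ` J))" if "finite J" "J \<subseteq> I" for J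
    using R that by (auto simp: \<P>_def)
  have delete: "\<exists>J. finite J \<and> J \<subseteq> I \<and> i \<notin> J \<and> card (\<Union>(N R ` J) \<union> (N R i - {x})) \<le> card J"
    if i: "i \<in> I" and x: "x \<in> N R i" for i x
  proof -
    have "insert (i, x) R \<notin> \<P>"
      using max[of "insert (i, x) R"] x by (auto simp: N_def)
    then obtain J where J: "finite J" "J \<subseteq> I" "card (\<Union>(N (insert (i, x) R) ` J)) < card J"
      by (auto simp: \<P>_def not_le)
    have other: "N (insert (i, x) R) j = N R j" if "j \<noteq> i" for j
      using that by (auto simp: N_def)
    have self: "N (insert (i, x) R) i = N R i - {x}"
      by (auto simp: N_def)
    have "i \<in> J"
    proof (rule ccontr)
      assume "i \<notin> J"
      then have "\<Union>(N (insert (i, x) R) ` J) = \<Union>(N R ` J)"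
        using other by (metis (no_types, lifting) SUP_cong)
      then show False using J hallR[of J] by simp
    qed
    then have "\<Union>(N (insert (i, x) R) ` J)
        = \<Union>(N (insert (i, x) R) ` (J - {i})) \<union> N (insert (i, x) R) i"
      by blast
    also have "\<Union>(N (insert (i, x) R) ` (J - {i})) = \<Union>(N R ` (J - {i}))"
      using other by (intro SUP_cong) auto
    finally have "\<Union>(N (insert (i, x) R) ` J) = \<Union>(N R ` (J - {i})) \<union> (N R i - {x})"
      by (simp only: self)
    then show ?thesis
      using J \<open>i \<in> J\<close> by (intro exI[of _ "J - {i}"]) (auto simp: card_Diff_singleton)
  qed
  have single: "x = y" if i: "i \<in> I" and x: "x \<in> N R i" and y: "y \<in> N R i" for i x y
  proof (rule ccontr)
    assume "x \<noteq> y"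
    obtain J where J: "finite J" "J \<subseteq> I" "i \<notin> J" "card (\<Union>(N R ` J) \<union> (N R i - {x})) \<le> card J"
      using delete[OF i x] by blast
    obtain K where K: "finite K" "K \<subseteq> I" "i \<notin> K" "card (\<Union>(N R ` K) \<union> (N R i - {y})) \<le> card K"
      using delete[OF i y] by blast
    define P where "P = \<Union>(N R ` J) \<union> (N R i - {x})"
    define Q where "Q = \<Union>(N R ` K) \<union> (N R i - {y})"
    have finPQ: "finite P" "finite Q"
      using finN[of J R] finN[of K R] finN[of "{i}" R] J K i by (auto simp: P_def Q_def)
    have "P \<union> Q = \<Union>(N R ` insert i (J \<union> K))"
      using \<open>x \<noteq> y\<close> by (auto simp: P_def Q_def)
    then have union: "Suc (card (J \<union> K)) \<le> card (P \<union> Q)"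
      using hallR[of "insert i (J \<union> K)"] J K i by simp
    have "\<Union>(N R ` (J \<inter> K)) \<subseteq> P \<inter> Q" by (auto simp: P_def Q_def)
    then have "card (\<Union>(N R ` (J \<inter> K))) \<le> card (P \<inter> Q)"
      using finPQ by (intro card_mono) auto
    moreover have "card (J \<inter> K) \<le> card (\<Union>(N R ` (J \<inter> K)))"
      using hallR[of "J \<inter> K"] J by auto
    ultimately have "card (J \<inter> K) \<le> card (P \<inter> Q)" by simp
    moreover have "card J + card K = card (J \<union> K) + card (J \<inter> K)"
      using J K by (intro card_Un_Int)
    moreover have "card P + card Q = card (P \<union> Q) + card (P \<inter> Q)"
      using finPQ by (intro card_Un_Int)
    ultimately show False using union J(4) K(4) by (simp add: P_def Q_def)
  qed
  have "\<exists>x. x \<in> N R i" if "i \<in> I" for i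
    using hallR[of "{i}"] that by (auto simp: card_gt_0_iff Suc_le_eq)
  then obtain \<sigma> where \<sigma>: "\<And>i. i \<in> I \<Longrightarrow> \<sigma> i \<in> N R i" by metis
  have "inj_on \<sigma> I"
  proof (rule inj_onI, rule ccontr)
    fix i j assume ij: "i \<in> I" "j \<in> I" "\<sigma> i = \<sigma> j" "i \<noteq> j"
    have "\<Union>(N R ` {i, j}) \<subseteq> {\<sigma> i}"
      using single \<sigma> ij by (metis UN_least insertE insert_subset singletonD singletonI subsetI)
    then have "card (\<Union>(N R ` {i, j})) \<le> 1"
      by (metis card.empty card_insert_if card_mono finite.emptyI finite.insertI One_nat_def empty_iff)
    then show False using hallR[of "{i, j}"] ij by simp
  qed
  then show thesis using \<sigma> that by (auto simp: N_def)
qed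

text \<open>The Cantor--Bernstein theorem in Banach's form: the bijection uses only pairs that occur in one
of the two injections. This is what keeps the image of an edge among its endpoints below.\<close>

lemma banach_mapping:
  assumes \<sigma>: "inj_on \<sigma> I" "\<sigma> ` I \<subseteq> V" and \<iota>: "inj_on \<iota> V" "\<iota> ` V \<subseteq> I"
  obtains \<tau> where "bij_betw \<tau> I V"
    and "\<And>i. i \<in> I \<Longrightarrow> \<tau> i = \<sigma> i \<or> \<iota> (\<tau> i) = i"
proof -
  \<comment> \<open>On \<open>A\<close> the bijection is \<open>\<sigma>\<close>, and off \<open>A\<close> it inverts \<open>\<iota>\<close>; the fixed-point equation makes
    the two images complementary.\<close>
  define A where "A = lfp (\<lambda>A. I - \<iota> ` (V - \<sigma> ` A))"
  have A: "A = I - \<iota> ` (V - \<sigma> ` A)"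
    unfolding A_def by (rule lfp_unfold) (rule monoI, blast)
  define \<tau> where "\<tau> i = (if i \<in> A then \<sigma> i else the_inv_into V \<iota> i)" for i
  have AI: "A \<subseteq> I" using A by blast
  have B: "I - A = \<iota> ` (V - \<sigma> ` A)" using A \<iota>(2) by blast
  have 1: "bij_betw \<tau> A (\<sigma> ` A)"
    using \<sigma>(1) AI by (auto simp: bij_betw_def \<tau>_def inj_on_def)
  have inv: "\<tau> (\<iota> v) = v" if "v \<in> V - \<sigma> ` A" for v
  proof -
    have "\<iota> v \<notin> A" using B that by blast
    then show ?thesis using \<iota>(1) that by (simp add: \<tau>_def the_inv_into_f_f)
  qed
  have 2: "bij_betw \<tau> (I - A) (V - \<sigma> ` A)"
    unfolding B by (rule bij_betw_byWitness[where f' = \<iota>]) (use inv in auto)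
  have "bij_betw \<tau> (A \<union> (I - A)) (\<sigma> ` A \<union> (V - \<sigma> ` A))"
    using 1 2 by (rule bij_betw_combine) blast
  moreover have "A \<union> (I - A) = I" "\<sigma> ` A \<union> (V - \<sigma> ` A) = V"
    using AI \<sigma>(2) by auto
  ultimately have "bij_betw \<tau> I V" by simp
  moreover have "\<tau> i = \<sigma> i \<or> \<iota> (\<tau> i) = i" if "i \<in> I" for i
  proof (cases "i \<in> A")
    case False
    then obtain v where "v \<in> V - \<sigma> ` A" "i = \<iota> v" using B \<open>i \<in> I\<close> by blast
    then show ?thesis using inv by simp
  qed (simp add: \<tau>_def)
  ultimately show thesis by (rule that)
qed

section \<open>Schreier graphs that are pseudoforests give paradoxical decompositions\<close>

text \<open>The Schreier graph of \<open>t False\<close> and \<open>t True\<close> on \<open>S\<close> has an edge \<open>(l, x)\<close> from \<open>x\<close> to \<open>t l\<close> applied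
to \<open>x\<close>, for every \<open>x\<close> and both labels \<open>l\<close>. A decomposition into four pieces comes from a
bijection \<open>\<tau>\<close> from edges to vertices that sends every edge to one of its endpoints: let \<open>Q l\<close> be
the points chosen as tails by edges with label \<open>l\<close>, and \<open>P l\<close> those chosen as heads only. Every
point lies in exactly one of these four sets, and undoing \<open>t l\<close> on \<open>P l\<close> completes \<open>Q l\<close> to
\<open>S\<close>, since each point is the tail of exactly one edge with label \<open>l\<close>.

The hypothesis \<open>sparse\<close> says that no finite subgraph has more edges than vertices. It is Hall's
condition for choosing distinct endpoints; conversely each vertex \<open>x\<close> can be given its own edge
\<open>(False, x)\<close>, and the Banach mapping theorem merges the two injections.\<close>

theorem (in group_action) paradoxical_using_4_of_pseudoforest:
  fixes t :: "bool \<Rightarrow> 'a"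
  assumes S: "S \<noteq> {}" "S \<subseteq> E"
    and t: "\<And>l. t l \<in> carrier G" "\<And>l. \<phi> (t l) ` S = S"
    and sparse: "\<And>J. finite J \<Longrightarrow> J \<subseteq> UNIV \<times> S \<Longrightarrow>
      card J \<le> card (\<Union>(l, x)\<in>J. {x, \<phi> (t l) x})"
  shows "paradoxical_using S 4"
proof -
  interpret group G using group_hom group_hom.axioms(1) by auto
  define ends where "ends = (\<lambda>(l, x). {x, \<phi> (t l) x})"
  obtain \<sigma> where \<sigma>: "inj_on \<sigma> (UNIV \<times> S)" "\<And>e. e \<in> UNIV \<times> S \<Longrightarrow> \<sigma> e \<in> ends e"
  proof (rule infinite_hall[of "UNIV \<times> S" ends])
    show "finite (ends e)" for e by (auto simp: ends_def split: prod.split)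
    show "card J \<le> card (\<Union>(ends ` J))" if "finite J" "J \<subseteq> UNIV \<times> S" for J
      using sparse[OF that] by (simp add: ends_def)
  qed blast
  have ends_S: "ends e \<subseteq> S" if "e \<in> UNIV \<times> S" for e
    using that t(2) by (auto simp: ends_def)
  obtain \<tau> where \<tau>: "bij_betw \<tau> (UNIV \<times> S) S"
    and \<tau>': "\<And>e. e \<in> UNIV \<times> S \<Longrightarrow> \<tau> e = \<sigma> e \<or> (False, \<tau> e) = e"
  proof (rule banach_mapping[of \<sigma> "UNIV \<times> S" S "Pair False"])
    show "\<sigma> ` (UNIV \<times> S) \<subseteq> S" using \<sigma>(2) ends_S by blast
  qed (use \<sigma>(1) in \<open>auto simp: inj_on_def\<close>)
  have \<tau>_ends: "\<tau> (l, x) \<in> {x, \<phi> (t l) x}" if "x \<in> S" for l x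
    using \<tau>'[of "(l, x)"] \<sigma>(2)[of "(l, x)"] that by (auto simp: ends_def)
  define Q where "Q l = {x \<in> S. \<tau> (l, x) = x}" for l
  define P where "P l = \<phi> (t l) ` (S - Q l)" for l
  have Q: "Q l = \<tau> ` ({l} \<times> Q l)" for l by (force simp: Q_def)
  have "\<tau> (l, x) = \<phi> (t l) x" if "x \<in> S - Q l" for l x
    using \<tau>_ends[of x l] that by (auto simp: Q_def)
  then have P: "P l = \<tau> ` ({l} \<times> (S - Q l))" for l by (force simp: P_def)
  have inj: "inj_on \<tau> (UNIV \<times> S)" and onto: "\<tau> ` (UNIV \<times> S) = S"
    using \<tau> by (auto simp: bij_betw_def)
  have QS: "Q l \<subseteq> S" for l by (auto simp: Q_def)
  have disj: "\<tau> ` U \<inter> \<tau> ` W = {}" if "U \<subseteq> UNIV \<times> S" "W \<subseteq> UNIV \<times> S" "U \<inter> W = {}" for U W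
    using inj_on_image_Int[OF inj that(1,2)] that(3) by simp
  have PQ_disj: "Q l \<inter> P l = {}" for l
    unfolding P by (subst Q, rule disj) (use QS in auto)
  have PQ: "Q l \<union> P l = \<tau> ` ({l} \<times> S)" for l
  proof -
    have "Q l \<union> P l = \<tau> ` ({l} \<times> Q l) \<union> \<tau> ` ({l} \<times> (S - Q l))"
      using P Q by metis
    also have "\<dots> = \<tau> ` ({l} \<times> S)"
      using QS[of l] by (auto simp flip: image_Un)
    finally show ?thesis .
  qed
  have labels: "(Q False \<union> P False) \<inter> (Q True \<union> P True) = {}"
    unfolding PQ by (rule disj) auto
  have "S = \<tau> ` ({False} \<times> S \<union> {True} \<times> S)"
    using onto by (simp add: UNIV_bool Sigma_Un_distrib1[symmetric] insert_commute)
  then have cover: "S = (Q False \<union> P False) \<union> (Q True \<union> P True)"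
    by (simp only: PQ image_Un)
  have one: "\<phi> \<one> ` Q l = Q l" for l
    using QS[of l] S(2) by (auto simp flip: id_eq_one simp: image_def subset_iff)
  have inv: "\<phi> (inv (t l)) ` P l = S - Q l" for l
  proof -
    have "\<phi> (inv (t l)) (\<phi> (t l) x) = x" if "x \<in> S" for x
      using orbit_sym_aux[OF t(1), of x] that S(2) by auto
    then show ?thesis unfolding P_def image_image by force
  qed
  define piece where "piece l i = (if i = 0 then Q l else P l)" for l and i :: nat
  define mover where "mover l i = (if i = 0 then \<one> else inv (t l))" for l and i :: nat
  have two: "{..<2::nat} = {0, 1}" by auto
  have img: "\<phi> (mover l i) ` piece l i = (if i = 0 then Q l else S - Q l)" for l i
    by (simp add: piece_def mover_def one inv)
  show ?thesis
    unfolding paradoxical_using_def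
  proof (intro conjI exI)
    show "0 < (2::nat)" "0 < (2::nat)" "2 + 2 = (4::nat)" by auto
    show "mover False \<in> {..<2} \<rightarrow> carrier G" "mover True \<in> {..<2} \<rightarrow> carrier G"
      using t(1) by (auto simp: mover_def)
    show "disjoint_family_on (piece False) {..<2}" "disjoint_family_on (piece True) {..<2}"
      using PQ_disj by (auto simp: two disjoint_family_on_def piece_def)
    show "\<Union> (piece False ` {..<2}) \<inter> \<Union> (piece True ` {..<2}) = {}"
      using labels by (simp add: two piece_def Un_commute)
    show "S = \<Union> (piece False ` {..<2}) \<union> \<Union> (piece True ` {..<2})"
      using cover by (simp add: two piece_def Un_commute)
    show "disjoint_family_on (\<lambda>i. \<phi> (mover False i) ` piece False i) {..<2}"
      "disjoint_family_on (\<lambda>j. \<phi> (mover True j) ` piece True j) {..<2}"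
      by (auto simp: two disjoint_family_on_def img)
    show "S = (\<Union>i<2. \<phi> (mover False i) ` piece False i)"
      "S = (\<Union>j<2. \<phi> (mover True j) ` piece True j)"
      using QS by (auto simp: two img)
  qed (use S in auto)
qed

section \<open>Labelled graphs with more edges than vertices\<close>

text \<open>A directed graph with edge labels in \<^typ>\<open>bool\<close> is a set of triples \<open>(l, x, y)\<close>, an edge from \<open>x\<close>
to \<open>y\<close> labelled \<open>l\<close>. A half-edge at a vertex is recorded by its label and by the direction of the
edge, \<open>True\<close> for outgoing; a loop therefore gives two half-edges.\<close>

definition half_edges :: "(bool \<times> 'v \<times> 'v) set \<Rightarrow> 'v \<Rightarrow> (bool \<times> bool) set"
  where "half_edges E x = {(l, d). \<exists>y. (l, if d then (x, y) else (y, x)) \<in> E}"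

definition vertices :: "(bool \<times> 'v \<times> 'v) set \<Rightarrow> 'v set"
  where "vertices E = (\<Union>(l, x, y)\<in>E. {x, y})"

text \<open>Each half-edge at a vertex will confine the vertex to one of four lines in general position, in a
limit. Two of them determine the vertex, three are contradictory; a core is a graph on which this
leaves no solution.\<close>

definition core :: "(bool \<times> 'v \<times> 'v) set \<Rightarrow> bool"
  where "core E \<longleftrightarrow> finite E \<and> (\<forall>x\<in>vertices E. 2 \<le> card (half_edges E x))
    \<and> (\<exists>x\<in>vertices E. 3 \<le> card (half_edges E x))"

definition partial_injections :: "(bool \<times> 'v \<times> 'v) set \<Rightarrow> bool"
  where "partial_injections E \<longleftrightarrow>
    (\<forall>l x y x' y'. (l, x, y) \<in> E \<longrightarrow> (l, x', y') \<in> E \<longrightarrow> (x = x' \<longleftrightarrow> y = y'))"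

lemma half_edges_iff: "(l, d) \<in> half_edges E x \<longleftrightarrow> (\<exists>y. (l, if d then (x, y) else (y, x)) \<in> E)"
  by (simp add: half_edges_def)

lemma partial_injectionsD:
  assumes "partial_injections E"
  shows "(l, x, y) \<in> E \<Longrightarrow> (l, x, y') \<in> E \<Longrightarrow> y = y'"
    and "(l, x, y) \<in> E \<Longrightarrow> (l, x', y) \<in> E \<Longrightarrow> x = x'"
  using assms unfolding partial_injections_def by metis+

lemma finite_vertices: "finite E \<Longrightarrow> finite (vertices E)"
  by (auto simp: vertices_def)

lemma vertices_iff: "x \<in> vertices E \<longleftrightarrow> half_edges E x \<noteq> {}"
proof
  assume "x \<in> vertices E"
  then obtain l y where "(l, x, y) \<in> E \<or> (l, y, x) \<in> E"
    by (auto simp: vertices_def)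
  then have "(l, True) \<in> half_edges E x \<or> (l, False) \<in> half_edges E x"
    by (auto simp: half_edges_iff)
  then show "half_edges E x \<noteq> {}" by blast
next
  assume "half_edges E x \<noteq> {}"
  then obtain l d where "(l, d) \<in> half_edges E x" by (metis ex_in_conv surj_pair)
  then obtain y where "(l, if d then (x, y) else (y, x)) \<in> E"
    unfolding half_edges_iff by blast
  then show "x \<in> vertices E" by (cases d) (force simp: vertices_def)+
qed

text \<open>The handshake lemma. As the edges with a given label form a partial injection, an edge end is
determined by its vertex, its label and its direction.\<close>

lemma sum_half_edges:
  assumes "finite E" "partial_injections E"
  shows "(\<Sum>x\<in>vertices E. card (half_edges E x)) = 2 * card E"
proof -
  define f :: "(bool \<times> 'a \<times> 'a) \<times> bool \<Rightarrow> 'a \<times> bool \<times> bool"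
    where "f = (\<lambda>((l, x, y), d). (if d then x else y, l, d))"
  have "(\<Sum>x\<in>vertices E. card (half_edges E x)) = card (SIGMA x:vertices E. half_edges E x)"
    using assms(1) by (simp add: finite_vertices)
  also have "(SIGMA x:vertices E. half_edges E x) = f ` (E \<times> UNIV)"
  proof (intro equalityI subsetI)
    fix u assume "u \<in> (SIGMA x:vertices E. half_edges E x)"
    then obtain x l d y where u: "u = (x, l, d)" "(l, if d then (x, y) else (y, x)) \<in> E"
      by (auto simp: half_edges_def)
    then have "u = f ((l, if d then (x, y) else (y, x)), d)"
      by (simp add: f_def)
    then show "u \<in> f ` (E \<times> UNIV)" using u by blast
  next
    fix u assume "u \<in> f ` (E \<times> UNIV)"
    then show "u \<in> (SIGMA x:vertices E. half_edges E x)"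
      by (fastforce simp: f_def half_edges_def vertices_def)
  qed
  also have "card (f ` (E \<times> UNIV)) = card (E \<times> (UNIV :: bool set))"
  proof (rule card_image, rule inj_onI)
    fix u v assume uv: "u \<in> E \<times> UNIV" "v \<in> E \<times> UNIV" "f u = f v"
    obtain l x y d where u: "u = ((l, x, y), d)" by (cases u) auto
    obtain l' x' y' d' where v: "v = ((l', x', y'), d')" by (cases v) auto
    show "u = v"
      using uv partial_injectionsD[OF assms(2)] unfolding u v f_def by (auto split: if_splits)
  qed
  finally show ?thesis by (simp add: card_cartesian_product)
qed

text \<open>Removing an edge at a vertex with a single half-edge removes that vertex as well, so the excess
of edges over vertices survives. Once no such vertex is left, a vertex with three half-edges
exists because the half-edges number more than twice the vertices.\<close>

lemma core_exists:
  assumes "finite E" "partial_injections E" "card (vertices E) < card E"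
  shows "\<exists>E'\<subseteq>E. core E'"
  using assms
proof (induction "card E" arbitrary: E rule: less_induct)
  case less
  note fin = less.prems(1) and pinj = less.prems(2) and dense = less.prems(3)
  show ?case
  proof (cases "\<exists>x\<in>vertices E. card (half_edges E x) < 2")
    case True
    then obtain x where x: "x \<in> vertices E" "card (half_edges E x) < 2" by blast
    have "card (half_edges E x) \<noteq> 0"
      using x(1) by (simp add: vertices_iff)
    then have "card (half_edges E x) = 1" using x(2) by linarith
    then obtain k where "half_edges E x = {k}" by (rule card_1_singletonE)
    then obtain l d where h: "half_edges E x = {(l, d)}" by (cases k) auto
    then have "(l, d) \<in> half_edges E x" by simp
    then obtain y where y: "(l, if d then (x, y) else (y, x)) \<in> E"
      unfolding half_edges_iff by blast
    define e where "e = (l, if d then (x, y) else (y, x))"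
    define E' where "E' = E - {e}"
    have only: "l' = l \<and> d' = d" if "(l', if d' then (x, z) else (z, x)) \<in> E" for l' d' z
    proof -
      have "(l', d') \<in> half_edges E x" unfolding half_edges_iff using that by blast
      then show ?thesis by (simp add: h)
    qed
    have "x \<notin> vertices E'"
    proof
      assume "x \<in> vertices E'"
      then obtain l' d' where "(l', d') \<in> half_edges E' x" by (auto simp: vertices_iff)
      then obtain z where z: "(l', if d' then (x, z) else (z, x)) \<in> E'"
        unfolding half_edges_iff by blast
      then have ld: "l' = l" "d' = d" using only[of l' d' z] by (simp_all add: E'_def)
      have "(l, if d then (x, z) else (z, x)) = e"
        using z y partial_injectionsD[OF pinj, of l] unfolding ld
        by (cases d) (auto simp: E'_def e_def)
      then show False using z ld by (simp add: E'_def)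
    qed
    moreover have "vertices E' \<subseteq> vertices E" by (auto simp: vertices_def E'_def)
    ultimately have "vertices E' \<subseteq> vertices E - {x}" by blast
    then have "card (vertices E') \<le> card (vertices E) - 1"
      using card_mono[of "vertices E - {x}"] fin x(1) by (simp add: finite_vertices)
    moreover have "0 < card (vertices E)"
      using x(1) fin by (auto simp: card_gt_0_iff finite_vertices)
    moreover have "card E' = card E - 1" "0 < card E"
      using y fin dense by (auto simp: E'_def e_def)
    moreover have "partial_injections E'"
      using pinj unfolding partial_injections_def E'_def by blast
    moreover have "finite E'" using fin by (simp add: E'_def)
    ultimately have "\<exists>E''\<subseteq>E'. core E''"
      using dense by (intro less.hyps) auto
    then show ?thesis by (auto simp: E'_def)
  next
    case False
    then have two: "\<forall>x\<in>vertices E. 2 \<le> card (half_edges E x)" by auto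
    have "\<exists>x\<in>vertices E. 3 \<le> card (half_edges E x)"
    proof (rule ccontr)
      assume "\<not> ?thesis"
      then have "(\<Sum>x\<in>vertices E. card (half_edges E x)) \<le> (\<Sum>x\<in>vertices E. 2)"
        by (intro sum_mono) auto
      then show False using sum_half_edges[OF fin pinj] dense by simp
    qed
    then show ?thesis using two fin by (auto simp: core_def)
  qed
qed

definition relabel :: "('v \<Rightarrow> 'w) \<Rightarrow> (bool \<times> 'v \<times> 'v) set \<Rightarrow> (bool \<times> 'w \<times> 'w) set"
  where "relabel f E = (\<lambda>(l, x, y). (l, f x, f y)) ` E"

lemma core_relabel:
  assumes "core E" "inj_on f (vertices E)"
  shows "core (relabel f E)"
proof -
  have V: "vertices (relabel f E) = f ` vertices E"
    by (force simp: vertices_def relabel_def)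
  have "half_edges (relabel f E) (f x) = half_edges E x" if x: "x \<in> vertices E" for x
  proof (intro equalityI subsetI; clarify)
    fix l d assume "(l, d) \<in> half_edges (relabel f E) (f x)"
    then obtain y where "(l, if d then (f x, y) else (y, f x)) \<in> relabel f E"
      unfolding half_edges_iff by blast
    then obtain u v where uv: "(l, u, v) \<in> E" "(if d then (f x, y) else (y, f x)) = (f u, f v)"
      by (auto simp: relabel_def)
    have "u \<in> vertices E" "v \<in> vertices E" using uv by (force simp: vertices_def)+
    then have "if d then u = x else v = x"
      using uv(2) x assms(2) by (auto simp: inj_on_def split: if_splits)
    then show "(l, d) \<in> half_edges E x"
      using uv(1) unfolding half_edges_iff by (cases d) auto
  next
    fix l d assume "(l, d) \<in> half_edges E x"
    then obtain y where "(l, if d then (x, y) else (y, x)) \<in> E"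
      unfolding half_edges_iff by blast
    then have "(l, if d then (f x, f y) else (f y, f x)) \<in> relabel f E"
      by (force simp: relabel_def split: if_splits)
    then show "(l, d) \<in> half_edges (relabel f E) (f x)"
      unfolding half_edges_iff by blast
  qed
  moreover have "finite (relabel f E)"
    using assms(1) by (simp add: core_def relabel_def)
  ultimately show ?thesis
    using assms(1) by (simp add: core_def V)
qed

section \<open>Linear pencils\<close>

text \<open>If the forms \<open>F h\<close> are jointly injective on a finite-dimensional space, the pencil \<open>s F - G\<close> has a
kernel for finitely many \<open>s\<close> only. The proof is the usual one for eigenvalues: kernel vectors for
distinct values of \<open>s\<close> are linearly independent.\<close>

theorem (in vector_space) finite_pencil_spectrum:
  fixes F G :: "'h \<Rightarrow> 'b \<Rightarrow> 'a"
  assumes F: "\<And>h. Vector_Spaces.linear scale (*) (F h)"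
    and G: "\<And>h. Vector_Spaces.linear scale (*) (G h)"
    and T: "finite T"
    and inj: "\<And>z. z \<in> span T \<Longrightarrow> (\<And>h. h \<in> H \<Longrightarrow> F h z = 0) \<Longrightarrow> z = 0"
  shows "finite {s. \<exists>z\<in>span T. z \<noteq> 0 \<and> (\<forall>h\<in>H. s * F h z = G h z)}"
proof (rule ccontr)
  define D where "D = {s. \<exists>z\<in>span T. z \<noteq> 0 \<and> (\<forall>h\<in>H. s * F h z = G h z)}"
  assume "infinite {s. \<exists>z\<in>span T. z \<noteq> 0 \<and> (\<forall>h\<in>H. s * F h z = G h z)}"
  then have "infinite D" by (simp add: D_def)
  then obtain C where C: "finite C" "C \<subseteq> D" "card C = Suc (card T)"
    by (meson infinite_arbitrarily_large)
  have "\<exists>z. \<forall>s\<in>D. z s \<in> span T \<and> z s \<noteq> 0 \<and> (\<forall>h\<in>H. G h (z s) = s * F h (z s))"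
    by (rule bchoice) (auto simp: D_def)
  then obtain z where z: "\<And>s. s \<in> D \<Longrightarrow> z s \<in> span T" "\<And>s. s \<in> D \<Longrightarrow> z s \<noteq> 0"
    and eq: "\<And>s h. s \<in> D \<Longrightarrow> h \<in> H \<Longrightarrow> G h (z s) = s * F h (z s)"
    by blast
  have sum: "F h (\<Sum>s\<in>B. scale (c s) (z s)) = (\<Sum>s\<in>B. c s * F h (z s))"
    "G h (\<Sum>s\<in>B. scale (c s) (z s)) = (\<Sum>s\<in>B. c s * G h (z s))" for h B c
  proof -
    interpret F: Vector_Spaces.linear scale "(*)" "F h" by (rule F)
    interpret G: Vector_Spaces.linear scale "(*)" "G h" by (rule G)
    show "F h (\<Sum>s\<in>B. scale (c s) (z s)) = (\<Sum>s\<in>B. c s * F h (z s))"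
      "G h (\<Sum>s\<in>B. scale (c s) (z s)) = (\<Sum>s\<in>B. c s * G h (z s))"
      by (simp_all add: F.sum F.scale G.sum G.scale)
  qed
  have in_span: "(\<Sum>s\<in>B. scale (c s) (z s)) \<in> span T" if "B \<subseteq> D" for B c
    using that z(1) by (intro span_sum span_scale) auto
  have indep: "\<forall>s\<in>B. c s = 0"
    if "finite B" "B \<subseteq> D" "(\<Sum>s\<in>B. scale (c s) (z s)) = 0" for B c
    using that
  proof (induction B arbitrary: c rule: finite_induct)
    case (insert t B)
    have "(\<Sum>s\<in>B. scale (c s * (s - t)) (z s)) = 0"
    proof (rule inj)
      fix h assume h: "h \<in> H"
      have "(\<Sum>s\<in>insert t B. c s * F h (z s)) = 0" "(\<Sum>s\<in>insert t B. c s * G h (z s)) = 0"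
        unfolding sum[symmetric] insert.prems(2) using sum[of h _ "{}"] by simp_all
      then have "0 = (\<Sum>s\<in>insert t B. c s * G h (z s)) - t * (\<Sum>s\<in>insert t B. c s * F h (z s))"
        by simp
      also have "\<dots> = (\<Sum>s\<in>insert t B. c s * G h (z s) - t * (c s * F h (z s)))"
        by (simp only: sum_distrib_left sum_subtractf)
      also have "\<dots> = (\<Sum>s\<in>insert t B. c s * (s - t) * F h (z s))"
        using insert.prems(1) h by (intro sum.cong) (auto simp: eq algebra_simps)
      also have "\<dots> = (\<Sum>s\<in>B. c s * (s - t) * F h (z s))"
        using insert.hyps by simp
      also have "\<dots> = F h (\<Sum>s\<in>B. scale (c s * (s - t)) (z s))"
        by (simp only: sum)
      finally show "F h (\<Sum>s\<in>B. scale (c s * (s - t)) (z s)) = 0" by simp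
    qed (use insert.prems in \<open>simp add: in_span\<close>)
    then have "\<forall>s\<in>B. c s * (s - t) = 0"
      using insert.prems(1) by (intro insert.IH) auto
    then have 0: "\<forall>s\<in>B. c s = 0" using insert.hyps by auto
    then have "scale (c t) (z t) = 0" using insert.prems(2) insert.hyps by simp
    then show ?case using 0 z(2)[of t] insert.prems(1) by auto
  qed simp
  have "inj_on z D"
  proof (rule inj_onI, rule ccontr)
    fix s t assume st: "s \<in> D" "t \<in> D" "z s = z t" "s \<noteq> t"
    have "\<forall>u\<in>{s, t}. (if u = s then 1 else - 1 :: 'a) = 0"
      using st by (intro indep) auto
    then show False by simp
  qed
  then have inj_C: "inj_on z C" using C(2) by (rule inj_on_subset)
  have "independent (z ` C)"
  proof (rule independent_if_scalars_zero)
    fix f x assume f: "(\<Sum>x\<in>z ` C. scale (f x) x) = 0" and x: "x \<in> z ` C"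
    then have "\<forall>s\<in>C. f (z s) = 0"
      using C inj_C by (intro indep) (simp_all add: sum.reindex)
    then show "f x = 0" using x by blast
  qed (use C in simp)
  then have "card (z ` C) \<le> card T"
    using independent_span_bound[OF T] C(2) z(1) by blast
  then show False using C(3) inj_C by (simp add: card_image)
qed

section \<open>Four lines in general position\<close>

text \<open>The line with index \<open>k = (l, d)\<close> is \<open>P k * x + Q k * y = R k\<close> in the affine plane. No two of the
four lines are parallel and no three are concurrent; the second condition is written in homogeneous
coordinates \<open>x\<close>, \<open>y\<close>, \<open>t\<close>, the form in which linear algebra will use it.
The indices are those of half-edges: the line
\<open>(l, True)\<close> belongs to tails and \<open>(l, False)\<close> to heads of edges with label \<open>l\<close>.\<close>

locale four_lines =
  fixes P Q R :: "bool \<times> bool \<Rightarrow> 'k::field"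
  assumes nonparallel: "k \<noteq> k' \<Longrightarrow> P k * Q k' \<noteq> Q k * P k'"
    and nonconcurrent: "3 \<le> card K \<Longrightarrow> (\<And>k. k \<in> K \<Longrightarrow> P k * x + Q k * y = R k * t) \<Longrightarrow> t = 0"
begin

definition form :: "bool \<times> bool \<Rightarrow> 'k \<times> 'k \<Rightarrow> 'k"
  where "form k p = P k * fst p + Q k * snd p"

text \<open>These two equations will hold between a point \<open>p\<close> and its image \<open>q\<close> under the plane map with label
\<open>l\<close> and parameter \<open>s\<close>. Dividing by \<open>s\<close> and formally letting \<open>s\<close> tend to infinity leaves
the conditions that \<open>p\<close> lies on the line \<open>(l, True)\<close> and \<open>q\<close> on the line \<open>(l, False)\<close>.\<close>

definition linked :: "'k \<Rightarrow> bool \<Rightarrow> 'k \<times> 'k \<Rightarrow> 'k \<times> 'k \<Rightarrow> bool"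
  where "linked s l p q \<longleftrightarrow>
    s * (form (l, True) p - R (l, True)) = form (l, False) q - form (l, False) p \<and>
    s * (form (l, False) q - R (l, False)) = form (l, True) q - form (l, True) p"

lemma two_lines_meet_at_origin:
  assumes "k \<noteq> k'" "P k * x + Q k * y = 0" "P k' * x + Q k' * y = 0"
  shows "x = 0 \<and> y = 0"
proof -
  have "(P k * Q k' - Q k * P k') * x = Q k' * (P k * x + Q k * y) - Q k * (P k' * x + Q k' * y)"
    "(P k * Q k' - Q k * P k') * y = P k * (P k' * x + Q k' * y) - P k' * (P k * x + Q k * y)"
    by (simp_all add: algebra_simps)
  then have "(P k * Q k' - Q k * P k') * x = 0" "(P k * Q k' - Q k * P k') * y = 0"
    by (simp_all only: assms(2,3) mult_zero_right diff_0_right)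
  then show ?thesis using nonparallel[OF assms(1)] by simp
qed

text \<open>The reason why the lines have to be in general position. Collect the equations \<open>linked\<close> for all
edges of \<open>E\<close>, homogenized by an extra unknown \<open>t\<close>: they have the form \<open>s F z = G z\<close> with linear forms
\<open>F\<close> and \<open>G\<close> that do not depend on \<open>s\<close>, one pair for each half-edge. If \<open>F z = 0\<close>, then each vertex lies
on the lines of its half-edges. The vertex on three lines forces \<open>t = 0\<close>, and then every vertex is
the common point \<open>0\<close> of two different lines through the origin. So \<open>F\<close> is injective and only
finitely many \<open>s\<close> admit a solution with \<open>t = 1\<close>.\<close>

lemma finite_exceptional_parameters:
  fixes E :: "(bool \<times> 'v \<times> 'v) set"
  assumes E: "core E"
  shows "finite {s. \<exists>p. \<forall>(l, x, y)\<in>E. linked s l (p x) (p y)}"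
proof -
  \<comment> \<open>An unknown \<open>z\<close> has the two coordinates of \<open>x\<close> at \<open>Some (x, False)\<close>, \<open>Some (x, True)\<close>
    and \<open>t\<close> at \<open>None\<close>.\<close>
  define sc where "sc = (\<lambda>(c::'k) (z :: ('v \<times> bool) option \<Rightarrow> 'k) i. c * z i)"
  interpret V: vector_space sc
    by unfold_locales (auto simp: sc_def fun_eq_iff algebra_simps)
  define I where "I = insert None (Some ` (vertices E \<times> (UNIV :: bool set)))"
  define unit where "unit i = (\<lambda>j. if j = i then 1 else 0 :: 'k)" for i :: "('v \<times> bool) option"
  have finI: "finite I" using E by (simp add: I_def core_def finite_vertices)
  have span1: "z i = 0" if "z \<in> V.span (unit ` I)" "i \<notin> I" for z i
    using that(1)
    by (induction rule: V.span_induct_alt) (use that(2) in \<open>auto simp: sc_def unit_def split: if_splits\<close>)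
  have span2: "z \<in> V.span (unit ` I)" if z: "\<And>i. i \<notin> I \<Longrightarrow> z i = 0" for z
  proof -
    have ev: "(\<Sum>i\<in>B. sc (z i) (unit i)) j = (if j \<in> B then z j else 0)" if "finite B" for B j
      using that by (induction B rule: finite_induct) (auto simp: sc_def unit_def)
    have "z = (\<Sum>i\<in>I. sc (z i) (unit i))"
      using z by (auto simp: fun_eq_iff ev[OF finI])
    moreover have "(\<Sum>i\<in>I. sc (z i) (unit i)) \<in> V.span (unit ` I)"
      by (intro V.span_sum V.span_scale V.span_base) auto
    ultimately show ?thesis by simp
  qed
  define pos where "pos z x = (z (Some (x, False)), z (Some (x, True)))"
    for z :: "('v \<times> bool) option \<Rightarrow> 'k" and x
  define F where "F = (\<lambda>((l, x, y), d) (z :: ('v \<times> bool) option \<Rightarrow> 'k).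
    form (l, d) (pos z (if d then x else y)) - R (l, d) * z None)"
  define G where "G = (\<lambda>((l, x, y), d) (z :: ('v \<times> bool) option \<Rightarrow> 'k).
    form (l, \<not> d) (pos z y) - form (l, \<not> d) (pos z x))"
  have "finite {s. \<exists>z\<in>V.span (unit ` I). z \<noteq> 0 \<and> (\<forall>h\<in>E \<times> UNIV. s * F h z = G h z)}"
  proof (rule V.finite_pencil_spectrum)
    show "Vector_Spaces.linear sc (*) (F h)" "Vector_Spaces.linear sc (*) (G h)" for h
    proof -
      obtain l x y d where h: "h = ((l, x, y), d)" by (cases h) auto
      show "Vector_Spaces.linear sc (*) (F h)" "Vector_Spaces.linear sc (*) (G h)"
        by (unfold_locales; simp add: h F_def G_def form_def pos_def sc_def algebra_simps)+
    qed
    show "finite (unit ` I)" using finI by simp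
    fix z assume z: "z \<in> V.span (unit ` I)" and Fz: "\<And>h. h \<in> E \<times> UNIV \<Longrightarrow> F h z = 0"
    have on_line: "P k * z (Some (x, False)) + Q k * z (Some (x, True)) = R k * z None"
      if k: "k \<in> half_edges E x" for k x
    proof -
      obtain l d where ld: "k = (l, d)" by (cases k)
      then obtain y where "(l, if d then (x, y) else (y, x)) \<in> E"
        using k unfolding ld half_edges_iff by blast
      then have "F ((l, if d then (x, y) else (y, x)), d) z = 0" by (intro Fz) auto
      then show ?thesis by (cases d) (simp_all add: F_def form_def pos_def ld)
    qed
    obtain x0 where "3 \<le> card (half_edges E x0)" using E by (auto simp: core_def)
    then have t: "z None = 0" using nonconcurrent on_line by blast
    have "z (Some (x, b)) = 0" if x: "x \<in> vertices E" for x b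
    proof -
      have "2 \<le> card (half_edges E x)" using E x by (auto simp: core_def)
      then obtain K where "K \<subseteq> half_edges E x" "card K = 2"
        by (metis obtain_subset_with_card_n)
      then obtain k k' where k: "k \<in> half_edges E x" "k' \<in> half_edges E x" "k \<noteq> k'"
        by (auto simp: card_2_iff)
      then have "z (Some (x, False)) = 0 \<and> z (Some (x, True)) = 0"
        using on_line[OF k(1)] on_line[OF k(2)] t
        by (intro two_lines_meet_at_origin[OF k(3)]) simp_all
      then show ?thesis by (cases b) auto
    qed
    then have "z i = 0" if "i \<in> I" for i using t that by (auto simp: I_def)
    then show "z = 0" using span1[OF z] by (auto simp: fun_eq_iff)
  qed
  moreover have "{s. \<exists>p. \<forall>(l, x, y)\<in>E. linked s l (p x) (p y)}
    \<subseteq> {s. \<exists>z\<in>V.span (unit ` I). z \<noteq> 0 \<and> (\<forall>h\<in>E \<times> UNIV. s * F h z = G h z)}"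
  proof clarify
    fix s p assume p: "\<forall>(l, x, y)\<in>E. linked s l (p x) (p y)"
    define z where "z i = (case i of None \<Rightarrow> 1 | Some (x, b) \<Rightarrow>
      if x \<in> vertices E then (if b then snd (p x) else fst (p x)) else 0)" for i
    have "z None = 1" by (simp add: z_def)
    then have "z \<noteq> 0" by auto
    moreover have "z \<in> V.span (unit ` I)"
      by (rule span2) (auto simp: z_def I_def split: option.split)
    moreover have "s * F h z = G h z" if h: "h \<in> E \<times> UNIV" for h
    proof -
      obtain l x y d where h': "h = ((l, x, y), d)" "(l, x, y) \<in> E"
        using h by (cases h) auto
      then have "x \<in> vertices E" "y \<in> vertices E" by (force simp: vertices_def)+
      then have "pos z x = p x" "pos z y = p y" by (simp_all add: pos_def z_def)
      moreover have "linked s l (p x) (p y)" using p h' by auto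
      ultimately show ?thesis
        using \<open>z None = 1\<close> unfolding h' F_def G_def linked_def by (cases d) auto
    qed
    ultimately show "\<exists>z\<in>V.span (unit ` I). z \<noteq> 0 \<and> (\<forall>h\<in>E \<times> UNIV. s * F h z = G h z)"
      by blast
  qed
  ultimately show ?thesis by (rule rev_finite_subset)
qed

text \<open>The graphs range over cores on natural numbers so that there are only countably many of them; any
finite graph can be relabelled in this way.\<close>

definition exceptional :: "'k set"
  where "exceptional = (\<Union>E\<in>{E :: (bool \<times> nat \<times> nat) set. core E}.
    {s. \<exists>p. \<forall>(l, x, y)\<in>E. linked s l (p x) (p y)})"

lemma countable_exceptional: "countable exceptional"
proof -
  have "countable {E :: (bool \<times> nat \<times> nat) set. core E}"
    by (rule countable_subset[OF _ countable_Collect_finite]) (auto simp: core_def)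
  then show ?thesis
    unfolding exceptional_def
    by (intro countable_UN) (auto intro: countable_finite finite_exceptional_parameters)
qed

text \<open>A finite piece of the Schreier graph with more edges than vertices contains a core, and the
coordinates of its points solve the equations \<open>linked\<close> along that core. Then \<open>s\<close> is exceptional.\<close>

theorem generic_pseudoforest:
  fixes T :: "bool \<Rightarrow> 'x \<Rightarrow> 'x" and \<pi> :: "'x \<Rightarrow> 'k \<times> 'k"
  assumes s: "s \<notin> exceptional"
    and inj: "\<And>l. inj (T l)"
    and linked: "\<And>l x. linked s l (\<pi> x) (\<pi> (T l x))"
    and J: "finite J"
  shows "card J \<le> card (\<Union>(l, x)\<in>J. {x, T l x})"
proof (rule ccontr)
  assume dense: "\<not> ?thesis"
  define E where "E = (\<lambda>(l, x). (l, x, T l x)) ` J"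
  have "card E = card J"
    unfolding E_def by (rule card_image) (auto simp: inj_on_def)
  moreover have "vertices E = (\<Union>(l, x)\<in>J. {x, T l x})"
    by (auto simp: vertices_def E_def)
  moreover have "partial_injections E"
    using inj by (auto simp: partial_injections_def E_def inj_def)
  moreover have "finite E" using J by (simp add: E_def)
  ultimately obtain E' where E': "E' \<subseteq> E" "core E'"
    using core_exists[of E] dense by auto
  then have "finite (vertices E')" by (simp add: core_def finite_vertices)
  then obtain f :: "'x \<Rightarrow> nat" where f: "inj_on f (vertices E')"
    using finite_imp_inj_to_nat_seg by blast
  define p where "p = (\<lambda>i. \<pi> (the_inv_into (vertices E') f i))"
  have p: "p (f x) = \<pi> x" if "x \<in> vertices E'" for x
    using f that by (simp add: p_def the_inv_into_f_f)
  have "\<forall>(l, x, y)\<in>relabel f E'. linked s l (p x) (p y)"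
  proof clarify
    fix l i j assume "(l, i, j) \<in> relabel f E'"
    then obtain x y where xy: "(l, x, y) \<in> E'" "i = f x" "j = f y" by (auto simp: relabel_def)
    then have "x \<in> vertices E'" "y \<in> vertices E'" by (force simp: vertices_def)+
    moreover have "y = T l x" using xy(1) E'(1) by (auto simp: E_def)
    ultimately show "linked s l (p i) (p j)" using linked p xy by simp
  qed
  moreover have "core (relabel f E')" using E'(2) f by (rule core_relabel)
  ultimately show False using s unfolding exceptional_def by blast
qed

end

text \<open>The lines are \<open>x = 0\<close> and \<open>y = 0\<close> for one label, \<open>x + y = 1\<close> and \<open>x + a y = b\<close> for the other.\<close>

lemma four_lines_exist:
  fixes a b :: "'k::field"
  assumes "a \<noteq> 0" "a \<noteq> 1" "b \<noteq> 0" "b \<noteq> 1" "a \<noteq> b"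
  shows "four_lines
    (\<lambda>(l, d). if l then 1 else if d then 1 else 0 :: 'k)
    (\<lambda>(l, d). if l then (if d then 1 else a) else if d then 0 else 1)
    (\<lambda>(l, d). if l then (if d then 1 else b) else 0)"
    (is "four_lines ?P ?Q ?R")
proof
  show "?P k * ?Q k' \<noteq> ?Q k * ?P k'" if "k \<noteq> k'" for k k'
    using that assms by (auto split: prod.splits if_splits)
next
  fix K :: "(bool \<times> bool) set" and x y t
  assume K: "3 \<le> card K" and eq: "\<And>k. k \<in> K \<Longrightarrow> ?P k * x + ?Q k * y = ?R k * t"
  have "\<exists>m. - {m} \<subseteq> K"
  proof (rule ccontr)
    assume "\<not> ?thesis"
    then have "\<exists>k k'. k \<noteq> k' \<and> k \<notin> K \<and> k' \<notin> K" by blast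
    then obtain k k' where "k \<noteq> k'" "K \<subseteq> UNIV - {k, k'}" by blast
    then have "card K \<le> 2"
      using card_mono[of "UNIV - {k, k'}" K] by (simp add: card_Diff_subset card_UNIV_bool)
    then show False using K by simp
  qed
  then obtain m where m: "k \<noteq> m \<Longrightarrow> ?P k * x + ?Q k * y = ?R k * t" for k
    using eq by blast
  have FT: "x = 0" if "m \<noteq> (False, True)" using m[of "(False, True)"] that by auto
  have FF: "y = 0" if "m \<noteq> (False, False)" using m[of "(False, False)"] that by auto
  have TT: "x + y = t" if "m \<noteq> (True, True)" using m[of "(True, True)"] that by auto
  have TF: "x + a * y = b * t" if "m \<noteq> (True, False)" using m[of "(True, False)"] that by auto
  have "m = (True, True) \<or> m = (True, False) \<or> m = (False, True) \<or> m = (False, False)"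
    by (cases m) auto
  then show "t = 0"
  proof (elim disjE)
    assume "m = (True, True)"
    then show ?thesis using FT FF TF assms by auto
  next
    assume "m = (True, False)"
    then show ?thesis using FT FF TT by auto
  next
    assume "m = (False, True)"
    then have "t = b * t" using FF TT TF by auto
    then show ?thesis using assms by auto
  next
    assume "m = (False, False)"
    then have "a * t = b * t" using FT TT TF by auto
    then show ?thesis using assms by auto
  qed
qed

section \<open>Bounded coordinates and small generic scalars\<close>

context nonarch_normed_space
begin

lemma nrm_minus: "nrm (- x) = nrm x"
  using nrm_scale[of "- 1" x] val_minus[of 1] val_one by simp

lemma nrm_zero: "nrm 0 = 0"
  by (simp add: nrm_eq_0_iff)

lemma nrm_diff_le: "nrm (x - y) \<le> max (nrm x) (nrm y)"
  using nrm_ultrametric[of x "- y"] by (simp add: nrm_minus)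

lemma nrm_add_small:
  assumes "nrm y < nrm x"
  shows "nrm (x + y) = nrm x"
  using nrm_ultrametric[of x y] nrm_diff_le[of "x + y" y] assms by auto

lemma nrm_sum_le:
  assumes "finite B" "0 \<le> e" "\<And>b. b \<in> B \<Longrightarrow> nrm (f b) \<le> e"
  shows "nrm (\<Sum>b\<in>B. f b) \<le> e"
  using assms(1,3)
proof (induction B rule: finite_induct)
  case (insert b B)
  then show ?case using nrm_ultrametric[of "f b" "\<Sum>b\<in>B. f b"] by fastforce
qed (use assms(2) in \<open>simp add: nrm_zero\<close>)

lemma val_zero: "val 0 = 0"
  by (simp add: val_eq_0_iff)

lemma complete_imp_limit:
  assumes "complete_field" and "\<And>e. 0 < e \<Longrightarrow> \<exists>N. \<forall>n\<ge>N. \<forall>m\<ge>N. val (c n - c m) < e"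
  obtains l where "\<And>e. 0 < e \<Longrightarrow> \<forall>\<^sub>F n in sequentially. val (c n - l) < e"
proof -
  interpret M: Metric_space UNIV "\<lambda>a b. val (a - b)" by (rule Metric_space_val)
  have "M.MCauchy c" using assms(2) by (auto simp: M.MCauchy_def)
  then obtain l where "limitin M.mtopology c l sequentially"
    using assms(1) by (auto simp: complete_field_def M.mcomplete_def)
  then show thesis using that by (auto simp: M.limitin_metric)
qed

text \<open>If coordinates with respect to \<open>B\<close> are bounded by the norm, then the span of \<open>B\<close> is closed: when
points of the span approach \<open>- b0\<close>, their coordinates are Cauchy and converge by completeness, and
the limit represents \<open>- b0\<close> in the span.\<close>

lemma dist_span_pos:
  assumes "complete_field" and B: "finite B" and b0: "b0 \<notin> span B"
    and bound: "0 < C" "\<And>c b. b \<in> B \<Longrightarrow> val (c b) \<le> C * nrm (\<Sum>b\<in>B. smul (c b) b)"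
  shows "\<exists>\<delta>>0. \<forall>c. \<delta> \<le> nrm (b0 + (\<Sum>b\<in>B. smul (c b) b))"
proof (rule ccontr)
  assume "\<not> ?thesis"
  then have "\<forall>\<delta>>0. \<exists>c. nrm (b0 + (\<Sum>b\<in>B. smul (c b) b)) < \<delta>" by (auto simp: not_le)
  then have "\<forall>n. \<exists>c. nrm (b0 + (\<Sum>b\<in>B. smul (c b) b)) < inverse (real (Suc n))"
    by (meson inverse_positive_iff_positive of_nat_0_less_iff zero_less_Suc)
  then obtain c where c: "\<And>n. nrm (b0 + (\<Sum>b\<in>B. smul (c n b) b)) < inverse (real (Suc n))"
    by metis
  define w where "w n = b0 + (\<Sum>b\<in>B. smul (c n b) b)" for n
  have small: "\<forall>\<^sub>F n in sequentially. nrm (w n) < e" if "0 < e" for e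
  proof -
    have "\<forall>\<^sub>F n in sequentially. inverse (real (Suc n)) < e"
      using LIMSEQ_inverse_real_of_nat that by (rule order_tendstoD)
    then show ?thesis by (rule eventually_mono) (use c in \<open>auto simp: w_def intro: less_trans\<close>)
  qed
  have "\<exists>l. \<forall>e>0. \<forall>\<^sub>F n in sequentially. val (c n b - l) < e" if b: "b \<in> B" for b
  proof -
    have "\<exists>N. \<forall>n\<ge>N. \<forall>m\<ge>N. val (c n b - c m b) < e" if "0 < e" for e
    proof -
      have "\<forall>\<^sub>F n in sequentially. nrm (w n) < e / C"
        using small that bound(1) by simp
      then obtain N where N: "\<And>n. n \<ge> N \<Longrightarrow> nrm (w n) < e / C"
        by (auto simp: eventually_sequentially)
      have "val (c n b - c m b) < e" if nm: "n \<ge> N" "m \<ge> N" for n m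
      proof -
        have "w n - w m = (\<Sum>b\<in>B. smul (c n b - c m b) b)"
          by (simp add: w_def scale_left_diff_distrib sum_subtractf)
        then have "val (c n b - c m b) \<le> C * nrm (w n - w m)"
          using bound(2)[OF b, of "\<lambda>b. c n b - c m b"] by simp
        moreover have "nrm (w n - w m) < e / C"
          using nrm_diff_le[of "w n" "w m"] N[OF nm(1)] N[OF nm(2)] by simp
        then have "C * nrm (w n - w m) < e"
          using bound(1) by (simp add: field_simps)
        ultimately show ?thesis by linarith
      qed
      then show ?thesis by blast
    qed
    then show ?thesis using complete_imp_limit[OF assms(1), of "\<lambda>n. c n b"] by metis
  qed
  then obtain l where l: "\<And>b e. b \<in> B \<Longrightarrow> 0 < e \<Longrightarrow> \<forall>\<^sub>F n in sequentially. val (c n b - l b) < e"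
    by metis
  define x where "x = b0 + (\<Sum>b\<in>B. smul (l b) b)"
  have "nrm x \<le> e" if e: "0 < e" for e
  proof -
    define M where "M = 1 + (\<Sum>b\<in>B. nrm b)"
    have M: "0 < M" "\<And>b. b \<in> B \<Longrightarrow> nrm b \<le> M"
      using nrm_nonneg member_le_sum[of _ B nrm] B by (fastforce simp: M_def sum_nonneg add_pos_nonneg)+
    have "\<forall>\<^sub>F n in sequentially. \<forall>b\<in>B. val (c n b - l b) < e / M"
      using B l e M(1) by (intro eventually_ball_finite) auto
    with small[OF e] have "\<forall>\<^sub>F n in sequentially. nrm (w n) < e \<and> (\<forall>b\<in>B. val (c n b - l b) < e / M)"
      by (rule eventually_conj)
    then obtain n where n: "nrm (w n) < e" "\<And>b. b \<in> B \<Longrightarrow> val (c n b - l b) < e / M"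
      using eventually_happens'[OF sequentially_bot] by blast
    have "nrm (smul (c n b - l b) b) \<le> e" if b: "b \<in> B" for b
    proof -
      have "val (c n b - l b) * nrm b \<le> (e / M) * M"
        using n(2)[OF b] M(2)[OF b] e M(1) by (intro mult_mono) (auto simp: nrm_nonneg)
      then show ?thesis using M(1) by (simp add: nrm_scale)
    qed
    then have "nrm (\<Sum>b\<in>B. smul (c n b - l b) b) \<le> e"
      using B e by (intro nrm_sum_le) auto
    moreover have "x = w n - (\<Sum>b\<in>B. smul (c n b - l b) b)"
      by (simp add: x_def w_def scale_left_diff_distrib sum_subtractf)
    ultimately show ?thesis
      using nrm_diff_le[of "w n" "\<Sum>b\<in>B. smul (c n b - l b) b"] n(1) by simp
  qed
  then have "nrm x \<le> 0" by (rule field_le_epsilon) simp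
  then have "x = 0" using nrm_nonneg[of x] nrm_eq_0_iff[of x] by simp
  then have "b0 = - (\<Sum>b\<in>B. smul (l b) b)" by (simp add: x_def eq_neg_iff_add_eq_0)
  moreover have "- (\<Sum>b\<in>B. smul (l b) b) \<in> span B"
    by (intro span_neg span_sum span_scale span_base)
  ultimately show False using b0 by simp
qed

text \<open>In the induction step the coordinate of the new vector \<open>b0\<close> is controlled by the positive
distance of \<open>b0\<close> from the span of the others, and the remaining coordinates by the induction hypothesis.\<close>

theorem coordinates_bounded:
  assumes "complete_field" "finite B" "independent B"
  shows "\<exists>C>0. \<forall>c. \<forall>b\<in>B. val (c b) \<le> C * nrm (\<Sum>b\<in>B. smul (c b) b)"
  using assms(2,3)
proof (induction B rule: finite_induct)
  case empty
  then show ?case by (auto intro: exI[of _ 1])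
next
  case (insert b0 B)
  have indep: "b0 \<notin> span B" "independent B"
    using insert.prems insert.hyps by (auto simp: independent_insert)
  obtain C where C: "0 < C" "\<And>c b. b \<in> B \<Longrightarrow> val (c b) \<le> C * nrm (\<Sum>b\<in>B. smul (c b) b)"
    using insert.IH[OF indep(2)] by blast
  obtain \<delta> where \<delta>: "0 < \<delta>" "\<And>c. \<delta> \<le> nrm (b0 + (\<Sum>b\<in>B. smul (c b) b))"
    using dist_span_pos[OF assms(1) insert.hyps(1) indep(1) C] by blast
  define C' where "C' = inverse \<delta> + C * (1 + inverse \<delta> * nrm b0)"
  have C': "0 < C'" using \<delta>(1) C(1) nrm_nonneg[of b0]
    by (auto simp: C'_def intro!: add_pos_nonneg)
  have "val (c b) \<le> C' * nrm (\<Sum>b\<in>insert b0 B. smul (c b) b)" if b: "b \<in> insert b0 B" for c b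
  proof -
    define y where "y = (\<Sum>b\<in>B. smul (c b) b)"
    define x where "x = smul (c b0) b0 + y"
    have sum: "(\<Sum>b\<in>insert b0 B. smul (c b) b) = x"
      using insert.hyps by (simp add: x_def y_def)
    have x0: "0 \<le> nrm x" by (rule nrm_nonneg)
    have first: "val (c b0) \<le> inverse \<delta> * nrm x"
    proof (cases "c b0 = 0")
      case True
      then show ?thesis using \<delta>(1) x0 by (simp add: val_zero)
    next
      case False
      have "x = smul (c b0) (b0 + (\<Sum>b\<in>B. smul (c b / c b0) b))"
        using False by (simp add: x_def y_def scale_right_distrib scale_sum_right)
      then have "nrm x = val (c b0) * nrm (b0 + (\<Sum>b\<in>B. smul (c b / c b0) b))"
        by (simp add: nrm_scale)
      then have "val (c b0) * \<delta> \<le> nrm x"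
        using \<delta>(2)[of "\<lambda>b. c b / c b0"] val_nonneg[of "c b0"] by (simp add: mult_left_mono)
      then show ?thesis using \<delta>(1) by (simp add: field_simps)
    qed
    have "nrm y \<le> max (nrm x) (val (c b0) * nrm b0)"
      using nrm_diff_le[of x "smul (c b0) b0"] by (simp add: x_def nrm_scale)
    also have "\<dots> \<le> nrm x + inverse \<delta> * nrm x * nrm b0"
      using mult_right_mono[OF first nrm_nonneg[of b0]] x0 \<delta>(1) nrm_nonneg[of b0]
      by (simp add: le_max_iff_disj max_def)
    finally have y: "nrm y \<le> (1 + inverse \<delta> * nrm b0) * nrm x"
      by (simp add: algebra_simps)
    show ?thesis
    proof (cases "b = b0")
      case True
      have "inverse \<delta> * nrm x \<le> C' * nrm x"
        using x0 C(1) \<delta>(1) nrm_nonneg[of b0] by (intro mult_right_mono) (auto simp: C'_def)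
      then have "val (c b0) \<le> C' * nrm x" using first by linarith
      then show ?thesis unfolding sum using True by simp
    next
      case False
      then have "val (c b) \<le> C * nrm y" using C(2)[of b c] b by (simp add: y_def)
      also have "\<dots> \<le> C * ((1 + inverse \<delta> * nrm b0) * nrm x)"
        using y C(1) by simp
      also have "\<dots> \<le> C' * nrm x"
        using x0 \<delta>(1) by (simp add: C'_def algebra_simps)
      finally show ?thesis unfolding sum .
    qed
  qed
  then show ?case using C' by blast
qed

lemma small_scalar_exists:
  assumes "nontrivial" "0 < e"
  shows "\<exists>a. a \<noteq> 0 \<and> val a < e"
proof -
  obtain a where a: "a \<noteq> 0" "val a \<noteq> 1"
    using assms(1) by (auto simp: nontrivial_def)
  have "\<exists>a. a \<noteq> 0 \<and> val a < 1"
  proof (cases "val a < 1")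
    case False
    have "val a * val (inverse a) = 1" using a(1) val_mult[of a "inverse a"] val_one by simp
    moreover have "1 < val a" using False a(2) by simp
    ultimately have "val (inverse a) < 1"
      using inverse_less_1_iff[of "val a"] by (simp add: inverse_unique)
    then show ?thesis using a(1) by (intro exI[of _ "inverse a"]) simp
  qed (use a in blast)
  then obtain a where a: "a \<noteq> 0" "val a < 1" by blast
  have pow: "val (a ^ n) = val a ^ n" for n
    by (induction n) (simp_all add: val_one val_mult)
  obtain n where "val a ^ n < e"
    using real_arch_pow_inv[OF assms(2) a(2)] by blast
  then show ?thesis using a(1) pow by (intro exI[of _ "a ^ n"]) simp
qed

text \<open>By Baire's theorem: points are nowhere dense, since the valuation is nontrivial.\<close>

theorem small_scalar_avoiding_countable:
  assumes "nontrivial" "complete_field" "countable A" "0 < e"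
  shows "\<exists>a. a \<notin> A \<and> val a < e"
proof (rule ccontr)
  assume contra: "\<not> ?thesis"
  interpret M: Metric_space UNIV "\<lambda>a b. val (a - b)" by (rule Metric_space_val)
  have "M.mtopology interior_of \<Union>((\<lambda>a. {a}) ` A) = {}"
  proof (rule M.metric_Baire_category_alt)
    show "M.mcomplete" using assms(2) by (simp add: complete_field_def)
    show "countable ((\<lambda>a. {a}) ` A)" using assms(3) by simp
    fix T assume "T \<in> (\<lambda>a. {a}) ` A"
    then obtain a where T: "T = {a}" by blast
    have "closedin M.mtopology {a}"
      by (simp add: closedin_Hausdorff_singleton M.Hausdorff_space_mtopology)
    moreover have "M.mtopology interior_of {a} = {}"
    proof (rule ccontr)
      assume "M.mtopology interior_of {a} \<noteq> {}"
      then have "a \<in> M.mtopology interior_of {a}"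
        using interior_of_subset by fastforce
      moreover have "openin M.mtopology (M.mtopology interior_of {a})" by simp
      ultimately obtain r where r: "0 < r" "M.mball a r \<subseteq> M.mtopology interior_of {a}"
        unfolding M.openin_mtopology by blast
      have "M.mball a r \<subseteq> {a}" using r(2) interior_of_subset by (rule order_trans)
      moreover obtain b where "b \<noteq> 0" "val b < r"
        using small_scalar_exists[OF assms(1) r(1)] by blast
      moreover from this have "a + b \<in> M.mball a r" using val_minus[of b] by (simp add: M.in_mball)
      ultimately have "a + b \<in> {a}" "b \<noteq> 0" by blast+
      then show False by simp
    qed
    ultimately show "closedin M.mtopology T \<and> M.mtopology interior_of T = {}"
      by (simp add: T)
  qed
  moreover have "M.mball 0 e \<subseteq> A"
    using contra by (auto simp: M.in_mball val_minus)
  then have "M.mball 0 e \<subseteq> M.mtopology interior_of A"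
    by (intro interior_of_maximal M.openin_mball)
  ultimately show False using assms(4) by (auto simp: M.centre_in_mball_iff)
qed

end

section \<open>Affine isometries\<close>

context nonarch_normed_space
begin

lemma affine_isometries_compose:
  assumes "f \<in> affine_isometries smul nrm" "g \<in> affine_isometries smul nrm"
  shows "f \<circ> g \<in> affine_isometries smul nrm"
proof -
  obtain L \<tau> M \<sigma> where f: "linear_isometry smul nrm L" "f = (\<lambda>x. L x + \<tau>)"
    and g: "linear_isometry smul nrm M" "g = (\<lambda>x. M x + \<sigma>)"
    using assms by (auto simp: affine_isometries_def)
  interpret L: Vector_Spaces.linear smul smul L
    using f(1) by (simp add: linear_isometry_def)
  have "f \<circ> g = (\<lambda>x. (L \<circ> M) x + (L \<sigma> + \<tau>))"
    using f g by (auto simp: L.add add.assoc)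
  then show ?thesis
    using linear_isometry_comp[OF f(1) g(1)] unfolding affine_isometries_def by blast
qed

lemma affine_isometry_dist:
  assumes "f \<in> affine_isometries smul nrm"
  shows "nrm (f x - f y) = nrm (x - y)"
proof -
  obtain L \<tau> where f: "linear_isometry smul nrm L" "f = (\<lambda>x. L x + \<tau>)"
    using assms by (auto simp: affine_isometries_def)
  interpret L: Vector_Spaces.linear smul smul L
    using f(1) by (simp add: linear_isometry_def)
  have "f x - f y = L (x - y)" by (simp add: f(2) L.diff)
  then show ?thesis using f(1) by (simp add: linear_isometry_def)
qed

lemma affine_isometry_bij:
  assumes "f \<in> affine_isometries smul nrm"
  shows "bij f"
proof -
  obtain L \<tau> where f: "linear_isometry smul nrm L" "f = (\<lambda>x. L x + \<tau>)"
    using assms by (auto simp: affine_isometries_def)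
  have "bij (\<lambda>x. x + \<tau>)"
    by (rule bij_betw_byWitness[where f' = "\<lambda>x. x - \<tau>"]) auto
  moreover have "f = (\<lambda>x. x + \<tau>) \<circ> L" using f(2) by auto
  ultimately show ?thesis using f(1) by (auto simp: linear_isometry_def intro: bij_comp)
qed

text \<open>For \<open>\<phi> v = 0\<close> this is a shear along \<open>v\<close> that fixes the hyperplane \<open>\<phi> = c\<close> pointwise.\<close>

definition transvection :: "'k \<Rightarrow> ('x \<Rightarrow> 'k) \<Rightarrow> 'k \<Rightarrow> 'x \<Rightarrow> 'x \<Rightarrow> 'x"
  where "transvection s \<phi> c v x = x + smul (s * (\<phi> x - c)) v"

text \<open>For small \<open>s\<close> the linear part moves every nonzero \<open>x\<close> by less than its norm, which in an
ultrametric space does not change the norm.\<close>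

lemma transvection_affine_isometry:
  assumes lin: "Vector_Spaces.linear smul (*) \<phi>" and v: "\<phi> v = 0"
    and bound: "\<And>x. val (\<phi> x) \<le> C * nrm x" and small: "val s * (C * nrm v) < 1"
  shows "transvection s \<phi> c v \<in> affine_isometries smul nrm"
proof -
  interpret \<phi>: Vector_Spaces.linear smul "(*)" \<phi> by (rule lin)
  define L where "L x = x + smul (s * \<phi> x) v" for x
  have "Vector_Spaces.linear smul smul L"
    by unfold_locales
      (auto simp: L_def \<phi>.add \<phi>.scale scale_right_distrib scale_left_distrib algebra_simps)
  moreover have "bij L"
    by (rule bij_betw_byWitness[where f' = "\<lambda>x. x - smul (s * \<phi> x) v"])
      (auto simp: L_def \<phi>.add \<phi>.diff \<phi>.scale v)
  moreover have "nrm (L x) = nrm x" for x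
  proof (cases "x = 0")
    case True
    then show ?thesis by (simp add: L_def \<phi>.zero)
  next
    case False
    then have x: "0 < nrm x" using nrm_nonneg[of x] nrm_eq_0_iff[of x] by simp
    have "nrm (smul (s * \<phi> x) v) = val s * nrm v * val (\<phi> x)"
      by (simp add: nrm_scale val_mult)
    also have "\<dots> \<le> val s * nrm v * (C * nrm x)"
      using bound by (intro mult_left_mono) (auto simp: val_nonneg nrm_nonneg)
    also have "\<dots> < 1 * nrm x"
      using mult_strict_right_mono[OF small x] by (simp add: mult_ac)
    finally show ?thesis unfolding L_def by (intro nrm_add_small) simp
  qed
  ultimately have "linear_isometry smul nrm L" by (simp add: linear_isometry_def)
  moreover have "transvection s \<phi> c v = (\<lambda>x. L x + smul (- (s * c)) v)"
    by (auto simp: transvection_def L_def right_diff_distrib scale_left_diff_distrib)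
  ultimately show ?thesis unfolding affine_isometries_def by blast
qed

lemma bounded_dual_pair:
  assumes "complete_field" "finite_dimensional_vector_space smul \<B>" "2 \<le> dim UNIV"
  shows "\<exists>C f e. 0 < C \<and> (\<forall>i::bool. Vector_Spaces.linear smul (*) (f i)) \<and>
    (\<forall>i j. f i (e j) = (if i = j then 1 else 0)) \<and> (\<forall>i x. val (f i x) \<le> C * nrm x)"
proof -
  interpret B: finite_dimensional_vector_space smul \<B> by (rule assms(2))
  have "2 \<le> card \<B>" using assms(3) by (simp add: B.dim_UNIV)
  then obtain K where "K \<subseteq> \<B>" "card K = 2"
    by (metis obtain_subset_with_card_n)
  then obtain b1 b2 where b: "b1 \<in> \<B>" "b2 \<in> \<B>" "b1 \<noteq> b2"
    by (auto simp: card_2_iff)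
  define e where "e i = (if i then b2 else b1)" for i
  define f where "f i x = representation \<B> x (e i)" for i x
  have eB: "e i \<in> \<B>" for i using b by (simp add: e_def)
  obtain C where C: "0 < C"
    "\<And>c b. b \<in> \<B> \<Longrightarrow> val (c b) \<le> C * nrm (\<Sum>b\<in>\<B>. smul (c b) b)"
    using coordinates_bounded[OF assms(1) B.finite_Basis B.independent_Basis] by blast
  show ?thesis
  proof (intro exI conjI allI)
    show "Vector_Spaces.linear smul (*) (f i)" for i
      unfolding f_def using B.independent_Basis B.span_Basis by (rule linear_representation)
    show "f i (e j) = (if i = j then 1 else 0)" for i j
      unfolding f_def representation_basis[OF B.independent_Basis eB] using b by (auto simp: e_def)
    show "val (f i x) \<le> C * nrm x" for i x
    proof -
      have "(\<Sum>b\<in>\<B>. smul (representation \<B> x b) b) = x"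
        by (rule sum_representation_eq)
          (auto simp: B.span_Basis B.independent_Basis B.finite_Basis)
      then show ?thesis using C(2)[OF eB, of "representation \<B> x" i] by (simp add: f_def)
    qed
  qed (rule C(1))
qed

section \<open>The paradoxical decomposition\<close>

lemma val_add_le: "val (a + b) \<le> val a + val b"
  using val_ultrametric[of a b] val_nonneg[of a] val_nonneg[of b] by simp

text \<open>An affine isometry that moves \<open>x\<^sub>0\<close> by less than \<open>r\<close> preserves distances from \<open>x\<^sub>0\<close> that are at least
\<open>r\<close>, and maps the open ball of radius \<open>r\<close> to itself. The saturation hypothesis makes \<open>S\<close> invariant
under all such isometries, and it holds for the space, balls and spheres alike.

Every index \<open>k\<close> of a line gives a functional \<open>\<phi> k\<close> on the space and a transvection \<open>\<theta> k\<close> that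
preserves \<open>\<phi> k\<close> and changes the functional of the other line with the same label by
\<open>s (\<phi> k - R k)\<close>. The isometry \<open>T l\<close> is the composition of the two transvections with label \<open>l\<close>: in
the first one \<open>\<phi> (l, True)\<close> is evaluated at \<open>x\<close>, and the second one preserves \<open>\<phi> (l, False)\<close>, so
that it may be evaluated at the image \<open>T l x\<close>. This is exactly the relation \<open>linked\<close>.\<close>

theorem radially_saturated_paradoxical:
  assumes field: "nontrivial" "complete_field"
    and dim: "finite_dimensional_vector_space smul \<B>" "2 \<le> dim UNIV"
    and r: "0 < r" and S: "S \<noteq> {}"
    and saturated: "\<And>x y. x \<in> S \<Longrightarrow>
      nrm (x - x\<^sub>0) = nrm (y - x\<^sub>0) \<or> nrm (x - x\<^sub>0) < r \<and> nrm (y - x\<^sub>0) < r \<Longrightarrow> y \<in> S"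
  shows "isometry_paradoxical smul nrm S 4"
proof -
  interpret act: group_action "affine_isometry_group smul nrm" UNIV "\<lambda>g. g"
    by (rule group_action_affine_isometries)
  obtain C f e where C: "0 < C" and f: "\<And>i::bool. Vector_Spaces.linear smul (*) (f i)"
    and dual: "\<And>i j. f i (e j) = (if i = j then 1 else 0)"
    and bound: "\<And>i x. val (f i x) \<le> C * nrm x"
    using bounded_dual_pair[OF field(2) dim] by blast
  obtain a where a: "a \<noteq> 0" "val a < 1"
    using small_scalar_exists[OF field(1), of 1] by auto
  \<comment> \<open>The parameters \<open>a\<close> and \<open>a * a\<close> of the lines differ from \<open>0\<close>, \<open>1\<close> and
    each other because \<open>0 < val a < 1\<close>.\<close>
  have "a \<noteq> 1" using a val_one by auto
  have "val (a * a) \<noteq> 1" using a val_nonneg[of a] mult_strict_mono[of "val a" 1 "val a" 1]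
    by (simp add: val_mult)
  then have "a * a \<noteq> 1" using val_one by auto
  have "a * a \<noteq> 0" "a \<noteq> a * a" using a \<open>a \<noteq> 1\<close> by auto
  with a(1) \<open>a \<noteq> 1\<close> \<open>a * a \<noteq> 1\<close> obtain P Q R :: "bool \<times> bool \<Rightarrow> 'k" where "four_lines P Q R"
    using four_lines_exist[of a "a * a"] by blast
  then interpret lines: four_lines P Q R .
  define \<pi> where "\<pi> x = (f False x, f True x)" for x
  define \<phi> where "\<phi> k x = lines.form k (\<pi> x)" for k x
  have \<phi>_eq: "\<phi> k x = P k * f False x + Q k * f True x" for k x
    by (simp add: \<phi>_def \<pi>_def lines.form_def)
  have \<phi>_linear: "Vector_Spaces.linear smul (*) (\<phi> k)" for k
  proof -
    interpret f: Vector_Spaces.linear smul "(*)" "f i" for i by (rule f)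
    show ?thesis by unfold_locales (auto simp: \<phi>_eq f.add f.scale algebra_simps)
  qed
  define M where "M k = (val (P k) + val (Q k)) * C" for k
  have \<phi>_bound: "val (\<phi> k x) \<le> M k * nrm x" for k x
  proof -
    have "val (\<phi> k x) \<le> val (P k) * val (f False x) + val (Q k) * val (f True x)"
      unfolding \<phi>_eq using val_add_le[of "P k * f False x" "Q k * f True x"] by (simp add: val_mult)
    also have "\<dots> \<le> val (P k) * (C * nrm x) + val (Q k) * (C * nrm x)"
      using bound by (intro add_mono mult_left_mono) (auto simp: val_nonneg)
    finally show ?thesis by (simp add: M_def algebra_simps)
  qed
  \<comment> \<open>\<open>u k\<close> is dual to the functional of the other line with the same label: \<open>\<phi> k\<close> vanishes on it
    and \<open>\<phi> (opp k)\<close> is \<open>1\<close> there.\<close>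
  define opp where "opp k = (fst k, \<not> snd k)" for k :: "bool \<times> bool"
  define u where "u k = smul (inverse (P k * Q (opp k) - Q k * P (opp k)))
    (smul (P k) (e True) - smul (Q k) (e False))" for k
  have \<phi>_u: "\<phi> k (u k) = 0" "\<phi> (opp k) (u k) = 1" for k
  proof -
    interpret f: Vector_Spaces.linear smul "(*)" "f i" for i by (rule f)
    have "k \<noteq> opp k" by (cases k) (auto simp: opp_def)
    then have "P k * Q (opp k) - Q k * P (opp k) \<noteq> 0"
      using lines.nonparallel by simp
    moreover have "\<phi> j (u k) = inverse (P k * Q (opp k) - Q k * P (opp k)) * (P k * Q j - Q k * P j)" for j
      by (simp add: \<phi>_eq u_def f.scale f.diff dual algebra_simps)
    ultimately show "\<phi> k (u k) = 0" "\<phi> (opp k) (u k) = 1"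
      by (simp_all add: mult.commute[of "Q k"])
  qed
  \<comment> \<open>The bound \<open>min 1 r / W\<close> on \<open>s\<close> makes all four transvections isometries that move \<open>x\<^sub>0\<close> by less
    than \<open>r\<close>.\<close>
  define W where "W = 1 + (\<Sum>k\<in>UNIV. (M k + val (\<phi> k x\<^sub>0 - R k)) * nrm (u k))"
  have M0: "0 \<le> M k" for k using C by (simp add: M_def val_nonneg)
  have term0: "0 \<le> (M k + val (\<phi> k x\<^sub>0 - R k)) * nrm (u k)" for k
    using M0 by (simp add: val_nonneg nrm_nonneg)
  have W: "0 < W" "(M k + val (\<phi> k x\<^sub>0 - R k)) * nrm (u k) \<le> W" for k
    using term0 member_le_sum[of k UNIV "\<lambda>k. (M k + val (\<phi> k x\<^sub>0 - R k)) * nrm (u k)"]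
    by (auto simp: W_def intro!: add_pos_nonneg sum_nonneg)
  obtain s where s: "s \<notin> lines.exceptional" "val s < min 1 r / W"
    using small_scalar_avoiding_countable[OF field lines.countable_exceptional, of "min 1 r / W"] r W(1)
    by auto
  have sW: "val s * W < min 1 r" using s(2) W(1) by (simp add: pos_less_divide_eq)
  have small: "val s * (M k * nrm (u k)) < 1" "val s * (val (\<phi> k x\<^sub>0 - R k) * nrm (u k)) < r" for k
  proof -
    have "val s * ((M k + val (\<phi> k x\<^sub>0 - R k)) * nrm (u k)) \<le> val s * W"
      using W(2) by (intro mult_left_mono) (auto simp: val_nonneg)
    moreover have "0 \<le> val s * (M k * nrm (u k))" "0 \<le> val s * (val (\<phi> k x\<^sub>0 - R k) * nrm (u k))"
      using M0 by (auto simp: val_nonneg nrm_nonneg)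
    ultimately show "val s * (M k * nrm (u k)) < 1" "val s * (val (\<phi> k x\<^sub>0 - R k) * nrm (u k)) < r"
      using sW by (auto simp: algebra_simps)
  qed
  define \<theta> where "\<theta> k = transvection s (\<phi> k) (R k) (u k)" for k
  have \<theta>: "\<theta> k \<in> affine_isometries smul nrm" for k
    unfolding \<theta>_def by (rule transvection_affine_isometry[OF \<phi>_linear \<phi>_u(1) \<phi>_bound small(1)])
  have \<theta>_x0: "nrm (\<theta> k x\<^sub>0 - x\<^sub>0) < r" for k
    using small(2)[of k] by (simp add: \<theta>_def transvection_def nrm_scale val_mult mult.assoc)
  have \<phi>_\<theta>: "\<phi> k (\<theta> k x) = \<phi> k x" "\<phi> (opp k) (\<theta> k x) = \<phi> (opp k) x + s * (\<phi> k x - R k)" for k x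
  proof -
    interpret \<phi>: Vector_Spaces.linear smul "(*)" "\<phi> k" for k by (rule \<phi>_linear)
    show "\<phi> k (\<theta> k x) = \<phi> k x" "\<phi> (opp k) (\<theta> k x) = \<phi> (opp k) x + s * (\<phi> k x - R k)"
      by (simp_all add: \<theta>_def transvection_def \<phi>.add \<phi>.scale \<phi>_u)
  qed
  define T where "T l = \<theta> (l, False) \<circ> \<theta> (l, True)" for l
  have T: "T l \<in> affine_isometries smul nrm" for l
    unfolding T_def by (intro affine_isometries_compose \<theta>)
  have T_x0: "nrm (T l x\<^sub>0 - x\<^sub>0) < r" for l
  proof -
    have "nrm (\<theta> (l, False) (\<theta> (l, True) x\<^sub>0) - \<theta> (l, False) x\<^sub>0) < r"
      using affine_isometry_dist[OF \<theta>] \<theta>_x0 by simp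
    then show ?thesis
      using nrm_ultrametric[of "\<theta> (l, False) (\<theta> (l, True) x\<^sub>0) - \<theta> (l, False) x\<^sub>0"
          "\<theta> (l, False) x\<^sub>0 - x\<^sub>0"] \<theta>_x0[of "(l, False)"]
      by (simp add: T_def)
  qed
  have linked: "lines.linked s l (\<pi> x) (\<pi> (T l x))" for l x
  proof -
    define x' where "x' = \<theta> (l, True) x"
    have y: "T l x = \<theta> (l, False) x'" by (simp add: T_def x'_def)
    show ?thesis
      using \<phi>_\<theta>(1)[of "(l, True)" x] \<phi>_\<theta>(2)[of "(l, True)" x]
        \<phi>_\<theta>(1)[of "(l, False)" x'] \<phi>_\<theta>(2)[of "(l, False)" x']
      unfolding lines.linked_def \<phi>_def[symmetric] y x'_def[symmetric] by (simp add: opp_def)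
  qed
  have radial: "nrm (x - x\<^sub>0) = nrm (T l x - x\<^sub>0) \<or> nrm (x - x\<^sub>0) < r \<and> nrm (T l x - x\<^sub>0) < r" for l x
  proof -
    show ?thesis
    proof (cases "nrm (x - x\<^sub>0) < r")
      case True
      then show ?thesis
        using nrm_ultrametric[of "T l x - T l x\<^sub>0" "T l x\<^sub>0 - x\<^sub>0"] T_x0[of l]
          affine_isometry_dist[OF T, of l x x\<^sub>0] by (auto split: if_splits simp: max_def)
    next
      case False
      then show ?thesis
        using nrm_add_small[of "T l x\<^sub>0 - x\<^sub>0" "T l x - T l x\<^sub>0"] T_x0[of l]
          affine_isometry_dist[OF T, of l x x\<^sub>0] by simp
    qed
  qed
  have T_S: "T l ` S = S" for l
  proof (intro equalityI subsetI)
    show "y \<in> S" if "y \<in> T l ` S" for y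
      using that saturated radial by blast
    show "y \<in> T l ` S" if "y \<in> S" for y
    proof -
      obtain x where x: "y = T l x" using affine_isometry_bij[OF T] by (meson bij_pointE)
      then have "x \<in> S" using saturated[OF that, of x] radial[of x l] by auto
      then show ?thesis using x by blast
    qed
  qed
  show ?thesis
  proof (rule act.paradoxical_using_4_of_pseudoforest[where t = T])
    show "T l \<in> carrier (affine_isometry_group smul nrm)" for l
      using T by (simp add: affine_isometry_group_def)
    show "card J \<le> card (\<Union>(l, x)\<in>J. {x, T l x})" if "finite J" for J
      using s(1) bij_is_inj[OF affine_isometry_bij[OF T]] linked that
      by (rule lines.generic_pseudoforest)
  qed (use S T_S in auto)
qed

end

theorem corollary3p11:
  fixes val :: "'k::field \<Rightarrow> real"
    and smul :: "'k \<Rightarrow> 'x::ab_group_add \<Rightarrow> 'x"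
    and nrm :: "'x \<Rightarrow> real"
    and Basis :: "'x set"
  assumes "nonarch_valued_field val"
    and "nonarch_valued_field.nontrivial val"
    and "nonarch_valued_field.complete_field val"
    and "nonarch_normed_space val smul nrm"
    and "finite_dimensional_vector_space smul Basis"
    and "vector_space.dim smul (UNIV :: 'x set) \<ge> 2"
  shows "isometry_paradoxical smul nrm UNIV 4
    \<and> (\<forall>x\<^sub>0 r. 0 < r \<longrightarrow> isometry_paradoxical smul nrm (closed_ball nrm x\<^sub>0 r) 4)
    \<and> (\<forall>x\<^sub>0 r. 0 < r \<longrightarrow> isometry_paradoxical smul nrm (open_ball nrm x\<^sub>0 r) 4)
    \<and> (\<forall>x\<^sub>0 r. 0 < r \<longrightarrow> nrm_sphere nrm x\<^sub>0 r \<noteq> {} \<longrightarrow>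
          isometry_paradoxical smul nrm (nrm_sphere nrm x\<^sub>0 r) 4)"
proof -
  interpret nonarch_normed_space val smul nrm by (rule assms(4))
  note paradoxical = radially_saturated_paradoxical[OF assms(2,3,5,6)]
  have center: "nrm (x\<^sub>0 - x\<^sub>0) = 0" for x\<^sub>0 by (simp add: nrm_zero)
  show ?thesis
  proof (intro conjI allI impI)
    show "isometry_paradoxical smul nrm UNIV 4"
      by (rule paradoxical[of 1 UNIV 0]) auto
    fix x\<^sub>0 and r :: real assume r: "0 < r"
    show "isometry_paradoxical smul nrm (closed_ball nrm x\<^sub>0 r) 4"
      by (rule paradoxical[OF r, of _ x\<^sub>0])
        (use r center[of x\<^sub>0] in \<open>auto simp: closed_ball_def intro!: exI[of _ x\<^sub>0]\<close>)
    show "isometry_paradoxical smul nrm (open_ball nrm x\<^sub>0 r) 4"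
      by (rule paradoxical[OF r, of _ x\<^sub>0])
        (use r center[of x\<^sub>0] in \<open>auto simp: open_ball_def intro!: exI[of _ x\<^sub>0]\<close>)
    show "isometry_paradoxical smul nrm (nrm_sphere nrm x\<^sub>0 r) 4"
      if "nrm_sphere nrm x\<^sub>0 r \<noteq> {}"
      by (rule paradoxical[OF r that, of x\<^sub>0]) (auto simp: nrm_sphere_def)
  qed
qed

end
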